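(* Let $q$ be a prime power and let $\mathcal{F}_q$ be the smallest class of simple matroids representable over $\mathbb{F}_q$ such that: (i) every supersolvable simple matroid representable over $\mathbb{F}_q$ belongs to $\mathcal{F}_q$; (ii) $\mathcal{F}_q$ is closed under taking modular joins over projective geometries, i.e. if a simple $\mathbb{F}_q$-representable matroid $M$ is a modular join $P_X(M_1,M_2)$ with $M_1,M_2\in\mathcal{F}_q$ and $M|X\simeq\mathrm{PG}(n,q)$ for some $n$, then $M\in\mathcal{F}_q$. If $\mathcal{A}$ is a central hyperplane arrangement over $\mathbb{F}_q$ whose linear dependence matroid belongs to $\mathcal{F}_q$, then $\mathcal{A}$ is divisionally free.
   Context: All matroids are finite. For a simple matroid $M$ on ground set $E$ with rank function $r$, flats ordered by inclusion form the lattice $L(M)$, with $X\vee Y=\mathrm{cl}(X\cup Y)$. A flat $X$ is modular if $r(X)+r(Y)=r(X\cap Y)+r(X\vee Y)$ for all flats $Y$. $M$ is supersolvable if it has a maximal chain of flats consisting of modular flats. $M=P_X(M_1,M_2)$ (a modular join over $X$) means there are proper modular flats $E_1,E_2$ with $E=E_1\cup E_2$, $X=E_1\cap E_2$, $M_i=M|E_i$. $\mathrm{PG}(n,q)$ is the simple matroid of all one-dimensional subspaces of $\mathbb{F}_q^{n+1}$ under linear dependence. $\chi(M,t)=\sum_{X\in L(M)}\mu(X)t^{r(E)-r(X)}$ ($\mu$ the Möbius function from the bottom), computed for contractions from their lattice of flats. A divisional flag of $M$ of rank $n$ is a chain of flats $\varnothing=X_0\subseteq\dots\subseteq X_n=E$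 with $r(X_i)=i$ and $\chi(M/X_{i+1},t)\mid\chi(M/X_i,t)$. The linear dependence matroid $M(\mathcal{A})$ of a central arrangement $\mathcal{A}$ is the matroid on $\mathcal{A}$ where $\{H_1,\dots,H_k\}$ is independent iff $\operatorname{codim}(H_1\cap\dots\cap H_k)=k$; $\mathcal{A}$ is divisionally free if $M(\mathcal{A})$ has a divisional flag. *)

theory Defs
  imports
    Complex_Main
    "HOL-Computational_Algebra.Polynomial"
    "HOL-Library.Function_Algebras"
begin

section \<open>Finite matroids\<close>

record 'a matroid_data =
  ground :: "'a set"
  indep :: "'a set set"

locale matroid =
  fixes M :: "'a matroid_data"
  assumes finite_ground: "finite (ground M)"
    and indep_subset: "I \<in> indep M \<Longrightarrow> I \<subseteq> ground M"
    and empty_indep: "{} \<in> indep M"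
    and indep_mono: "I \<in> indep M \<Longrightarrow> J \<subseteq> I \<Longrightarrow> J \<in> indep M"
    and augment: "I \<in> indep M \<Longrightarrow> J \<in> indep M \<Longrightarrow> card I < card J \<Longrightarrow>
      \<exists>x \<in> J - I. insert x I \<in> indep M"

text \<open>Simple: there are neither loops nor parallel elements.\<close>

definition simple_matroid :: "'a matroid_data \<Rightarrow> bool" where
  "simple_matroid M \<longleftrightarrow> matroid M \<and> (\<forall>x \<in> ground M. \<forall>y \<in> ground M. {x, y} \<in> indep M)"

definition mrank :: "'a matroid_data \<Rightarrow> 'a set \<Rightarrow> nat" where
  "mrank M X = Max (card ` {I \<in> indep M. I \<subseteq> X})"

definition cl :: "'a matroid_data \<Rightarrow> 'a set \<Rightarrow> 'a set" where
  "cl M X = {x \<in> ground M. mrank M (insert x X) = mrank M X}"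

definition flats :: "'a matroid_data \<Rightarrow> 'a set set" where
  "flats M = {X. X \<subseteq> ground M \<and> cl M X = X}"

definition restriction :: "'a matroid_data \<Rightarrow> 'a set \<Rightarrow> 'a matroid_data" where
  "restriction M X = \<lparr>ground = X, indep = {I \<in> indep M. I \<subseteq> X}\<rparr>"

text \<open>The contraction \<open>M / X\<close> has rank function \<open>Y \<mapsto> r(Y \<union> X) - r(X)\<close>, so a set is
  independent in it if its cardinality equals this rank.\<close>

definition contraction :: "'a matroid_data \<Rightarrow> 'a set \<Rightarrow> 'a matroid_data" where
  "contraction M X =
    \<lparr>ground = ground M - X,
     indep = {I. I \<subseteq> ground M - X \<and> mrank M (I \<union> X) = card I + mrank M X}\<rparr>"

definition matroid_iso :: "'a matroid_data \<Rightarrow> 'b matroid_data \<Rightarrow> bool" where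
  "matroid_iso M N \<longleftrightarrow>
    (\<exists>f. bij_betw f (ground M) (ground N) \<and>
         (\<forall>I \<subseteq> ground M. I \<in> indep M \<longleftrightarrow> f ` I \<in> indep N))"

section \<open>Modular flats, supersolvability and modular joins\<close>

definition modular_flat :: "'a matroid_data \<Rightarrow> 'a set \<Rightarrow> bool" where
  "modular_flat M X \<longleftrightarrow> X \<in> flats M \<and>
    (\<forall>Y \<in> flats M. mrank M X + mrank M Y = mrank M (X \<inter> Y) + mrank M (cl M (X \<union> Y)))"

definition supersolvable :: "'a matroid_data \<Rightarrow> bool" where
  "supersolvable M \<longleftrightarrow> (\<exists>C. subset.maxchain (flats M) C \<and> (\<forall>X \<in> C. modular_flat M X))"

definition modular_join ::
  "'a matroid_data \<Rightarrow> 'a set \<Rightarrow> 'a matroid_data \<Rightarrow> 'a matroid_data \<Rightarrow> bool" where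
  "modular_join M X M1 M2 \<longleftrightarrow>
    (\<exists>E1 E2. modular_flat M E1 \<and> E1 \<noteq> ground M \<and> modular_flat M E2 \<and> E2 \<noteq> ground M \<and>
       ground M = E1 \<union> E2 \<and> X = E1 \<inter> E2 \<and> M1 = restriction M E1 \<and> M2 = restriction M E2)"

section \<open>Characteristic polynomial and divisional flags\<close>

text \<open>\<open>moebius M X\<close> is \<open>\<mu>(0, X)\<close> in the lattice of flats, whose bottom is \<open>cl M {}\<close>.
  The condition \<open>finite X\<close> only serves termination; flats of a matroid are finite.\<close>

function moebius :: "'a matroid_data \<Rightarrow> 'a set \<Rightarrow> int" where
  "moebius M X =
    (if X = cl M {} then 1
     else - (\<Sum>Y \<in> {Y \<in> flats M. finite X \<and> Y \<subset> X}. moebius M Y))"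
  by pat_completeness auto
termination
proof (relation "inv_image finite_psubset snd")
  show "wf (inv_image finite_psubset (snd :: 'a matroid_data \<times> 'a set \<Rightarrow> 'a set))"
    by simp
qed (simp add: finite_psubset_def)

declare moebius.simps [simp del]

definition charpoly :: "'a matroid_data \<Rightarrow> int poly" where
  "charpoly M =
    (\<Sum>X \<in> flats M. monom (moebius M X) (mrank M (ground M) - mrank M X))"

definition divisional_flag :: "'a matroid_data \<Rightarrow> (nat \<Rightarrow> 'a set) \<Rightarrow> bool" where
  "divisional_flag M X \<longleftrightarrow>
    (let n = mrank M (ground M) in
       X 0 = {} \<and> X n = ground M \<and>
       (\<forall>i \<le> n. X i \<in> flats M \<and> mrank M (X i) = i) \<and>
       (\<forall>i < n. X i \<subseteq> X (Suc i) \<and>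
          charpoly (contraction M (X (Suc i))) dvd charpoly (contraction M (X i))))"

section \<open>Representability and projective geometries\<close>

text \<open>The coordinate space \<open>F^d\<close>, for \<open>d\<close> a natural number, is the space of the
  sequences over \<open>F\<close> that vanish from index \<open>d\<close> on.\<close>

definition seq_scale :: "'f::field \<Rightarrow> (nat \<Rightarrow> 'f) \<Rightarrow> nat \<Rightarrow> 'f" where
  "seq_scale c v = (\<lambda>i. c * v i)"

global_interpretation seq: vector_space seq_scale
  by unfold_locales (auto simp: seq_scale_def fun_eq_iff algebra_simps)

definition coord_space :: "nat \<Rightarrow> (nat \<Rightarrow> 'f::field) set" where
  "coord_space d = {v. \<forall>i \<ge> d. v i = 0}"

definition representable :: "'f::field itself \<Rightarrow> 'a matroid_data \<Rightarrow> bool" where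
  "representable F M \<longleftrightarrow>
    (\<exists>d (\<phi> :: 'a \<Rightarrow> nat \<Rightarrow> 'f). \<phi> ` ground M \<subseteq> coord_space d \<and>
       (\<forall>I \<subseteq> ground M. I \<in> indep M \<longleftrightarrow> inj_on \<phi> I \<and> seq.independent (\<phi> ` I)))"

text \<open>\<open>proj_geom F d\<close> is \<open>PG(d - 1, F)\<close>, on the lines through the origin of \<open>F^d\<close>;
  lines are independent if their sum has dimension equal to their number.
  The value \<open>d = 0\<close> gives the empty geometry \<open>PG(-1, F)\<close>.\<close>

definition proj_geom :: "'f::field itself \<Rightarrow> nat \<Rightarrow> (nat \<Rightarrow> 'f) set matroid_data" where
  "proj_geom F d =
    (let P = {L. seq.subspace L \<and> seq.dim L = 1 \<and> L \<subseteq> coord_space d}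
     in \<lparr>ground = P, indep = {S. S \<subseteq> P \<and> finite S \<and> seq.dim (seq.span (\<Union>S)) = card S}\<rparr>)"

text \<open>This is the class \<open>\<F>\<^sub>q\<close> for \<open>q = CARD('f)\<close> when the field \<open>'f\<close> is finite.
  The constituents of a modular join are restrictions of the joined matroid, so the
  smallest class of all matroids restricts, on each type of ground elements, to the class
  generated there.\<close>

inductive pg_join_class :: "'f::field itself \<Rightarrow> 'a matroid_data \<Rightarrow> bool"
  for F :: "'f itself" where
  supersolvable:
    "simple_matroid M \<Longrightarrow> representable F M \<Longrightarrow> supersolvable M \<Longrightarrow> pg_join_class F M"
| join:
    "simple_matroid M \<Longrightarrow> representable F M \<Longrightarrow> modular_join M X M1 M2 \<Longrightarrow>
     pg_join_class F M1 \<Longrightarrow> pg_join_class F M2 \<Longrightarrow>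
     matroid_iso (restriction M X) (proj_geom F d) \<Longrightarrow> pg_join_class F M"

section \<open>Hyperplane arrangements\<close>

definition codim :: "('f::field \<Rightarrow> 'v::ab_group_add \<Rightarrow> 'v) \<Rightarrow> 'v set \<Rightarrow> nat" where
  "codim scale W = vector_space.dim scale UNIV - vector_space.dim scale W"

text \<open>Central: all hyperplanes pass through the origin.\<close>

definition central_arrangement ::
  "('f::field \<Rightarrow> 'v::ab_group_add \<Rightarrow> 'v) \<Rightarrow> 'v set set \<Rightarrow> bool" where
  "central_arrangement scale \<A> \<longleftrightarrow>
    finite \<A> \<and> (\<forall>H \<in> \<A>. module.subspace scale H \<and> codim scale H = 1)"

definition dependence_matroid ::
  "('f::field \<Rightarrow> 'v::ab_group_add \<Rightarrow> 'v) \<Rightarrow> 'v set set \<Rightarrow> 'v set matroid_data" where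
  "dependence_matroid scale \<A> =
    \<lparr>ground = \<A>, indep = {B. B \<subseteq> \<A> \<and> codim scale (\<Inter>B) = card B}\<rparr>"

definition divisionally_free ::
  "('f::field \<Rightarrow> 'v::ab_group_add \<Rightarrow> 'v) \<Rightarrow> 'v set set \<Rightarrow> bool" where
  "divisionally_free scale \<A> \<longleftrightarrow> (\<exists>X. divisional_flag (dependence_matroid scale \<A>) X)"

end

(*
  A supersolvable matroid has a divisional flag because, for a modular coatom H and a point a
  outside H, the interval above a is isomorphic to the interval below H, and chi(H) divides chi(M)
  by Stanley's modular factorization; contracting a thus amounts to passing to H.

  For a modular join of A and B over X, factorization gives chi(M/Y) = chi(A/Y) Q with a factor Q
  that does not depend on Y as long as Y is a flat of A disjoint from B. So a divisional path of A
  that avoids X and ends in a complement of X is also one of M, and there M/Y is isomorphic to B,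
  where one continues with a path of B. To make this an induction, one proves more: for every
  modular flat X whose lines have at least three points there is a divisional path that avoids X
  and ends in a complement of X. The three-point condition is what projective geometries provide;
  it forces X into one of the two sides of a modular join.
*)

theory Submission
  imports Defs
begin

text \<open>All contractions of restrictions are treated as intervals [Y, T] of the one lattice of
  flats of \<open>M\<close>. They are compared through the diamond isomorphism between
  [A \<inter> Y, A] and [Y, A \<or> Y] that a modular flat A provides; \<open>contraction\<close>
  and \<open>restriction\<close> enter only to translate hypotheses and conclusion. The obstacle is
  that an arbitrary flag of A does not serve in a join: once a flat Y of A meets B, the
  complementary factor may change and divisibility is no longer guaranteed. So A needs a path around
  A \<inter> B; and since a later join may overlap inside B, the path in B must go around a
  prescribed flat as well. Asking this flat to be a projective geometry would mean carrying
  isomorphisms along, because the induction cuts X with flats and projects it from a point into a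
  modular coatom. A third point on each line survives both operations by rank counts. The flag
  itself is the case X = {}, whose only complement is the ground set.\<close>

section \<open>Rank and closure\<close>

context matroid
begin

abbreviation E where "E \<equiv> ground M"
abbreviation r where "r \<equiv> mrank M"
abbreviation L where "L \<equiv> flats M"

lemma finite_indep: "I \<in> indep M \<Longrightarrow> finite I"
  using indep_subset finite_ground finite_subset by blast

lemma finite_indep_set: "finite (indep M)"
  by (rule finite_subset[of _ "Pow E"]) (use indep_subset finite_ground in auto)

lemma card_le_rank: "I \<in> indep M \<Longrightarrow> I \<subseteq> X \<Longrightarrow> card I \<le> r X"
  unfolding mrank_def using finite_indep_set by (intro Max_ge) auto

lemma basis_exists:
  obtains I where "I \<in> indep M" "I \<subseteq> X" "card I = r X"
proof -
  have "r X \<in> card ` {I \<in> indep M. I \<subseteq> X}"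
    unfolding mrank_def using finite_indep_set empty_indep by (intro Max_in) auto
  then show thesis using that by auto
qed

lemma rank_indep: "I \<in> indep M \<Longrightarrow> r I = card I"
  by (metis basis_exists card_le_rank card_mono finite_indep le_antisym order_refl)

lemma rank_mono: "X \<subseteq> Y \<Longrightarrow> r X \<le> r Y"
  by (metis basis_exists card_le_rank order_trans)

lemma rank_empty [simp]: "r {} = 0"
  using rank_indep[OF empty_indep] by simp

lemma rank_le_card: "finite X \<Longrightarrow> r X \<le> card X"
  by (metis basis_exists card_mono)

lemma indep_iff_rank: "I \<in> indep M \<longleftrightarrow> finite I \<and> r I = card I"
  by (metis basis_exists card_subset_eq finite_indep rank_indep)

lemma extend_basis:
  assumes "I \<in> indep M" "I \<subseteq> X"
  obtains B where "B \<in> indep M" "I \<subseteq> B" "B \<subseteq> X" "card B = r X"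
proof -
  define S where "S = {B \<in> indep M. I \<subseteq> B \<and> B \<subseteq> X}"
  have "finite S" "I \<in> S" using finite_indep_set assms by (auto simp: S_def)
  then have "finite (card ` S)" "card ` S \<noteq> {}" by auto
  from Max_in[OF this] obtain B where B: "B \<in> S" "card B = Max (card ` S)" by auto
  have max: "card C \<le> card B" if "C \<in> S" for C
    using that B \<open>finite S\<close> by simp
  have "\<not> card B < r X"
  proof
    assume "card B < r X"
    obtain J where J: "J \<in> indep M" "J \<subseteq> X" "card J = r X" by (rule basis_exists)
    with \<open>card B < r X\<close> B obtain x where x: "x \<in> J - B" "insert x B \<in> indep M"
      using augment[of B J] by (auto simp: S_def)
    then have "insert x B \<in> S" using B J by (auto simp: S_def)
    from max[OF this] x B finite_indep[of B] show False by (auto simp: S_def)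
  qed
  then have "card B = r X" using B card_le_rank[of B X] by (auto simp: S_def)
  then show thesis using that B by (auto simp: S_def)
qed

lemma rank_submodular: "r (A \<union> B) + r (A \<inter> B) \<le> r A + r B"
proof -
  obtain I where I: "I \<in> indep M" "I \<subseteq> A \<inter> B" "card I = r (A \<inter> B)" by (rule basis_exists)
  obtain J where J: "J \<in> indep M" "I \<subseteq> J" "J \<subseteq> A" "card J = r A"
    using extend_basis[of I A] I by auto
  obtain K where K: "K \<in> indep M" "J \<subseteq> K" "K \<subseteq> A \<union> B" "card K = r (A \<union> B)"
    using extend_basis[of J "A \<union> B"] J by auto
  have fin: "finite K" by (rule finite_indep) fact
  have ind: "K \<inter> S \<in> indep M" for S using indep_mono[OF K(1)] by auto
  have "card (K \<inter> A) \<le> r A" "card (K \<inter> B) \<le> r B"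
    using card_le_rank[OF ind] by auto
  moreover have "card I \<le> card ((K \<inter> A) \<inter> (K \<inter> B))"
    using I J K fin by (intro card_mono) auto
  moreover have "card (K \<inter> A) + card (K \<inter> B) = card K + card ((K \<inter> A) \<inter> (K \<inter> B))"
    using card_Un_Int[of "K \<inter> A" "K \<inter> B"] fin K(3) by (simp add: Int_Un_distrib[symmetric] Int_absorb2)
  ultimately show ?thesis using I K by linarith
qed

lemma rank_submodular_le:
  assumes "A \<subseteq> C" "B \<subseteq> C" "D \<subseteq> A" "D \<subseteq> B" "C \<subseteq> A \<union> B"
  shows "r C + r D \<le> r A + r B"
proof -
  have "C = A \<union> B" using assms by auto
  then show ?thesis using rank_submodular[of A B] rank_mono[of D "A \<inter> B"] assms by simp
qed

lemma rank_insert_le: "r (insert x A) \<le> Suc (r A)"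
  using rank_submodular[of "{x}" A] rank_le_card[of "{x}"] by simp

lemma rank_insert_cases: "r (insert x A) = r A \<or> r (insert x A) = Suc (r A)"
  using rank_insert_le[of x A] rank_mono[of A "insert x A"] by force

text \<open>Otherwise a basis of \<open>A\<close> would extend by some \<open>x\<close> of
  \<open>B\<close> to an independent set, and this single \<open>x\<close> would already raise the
  rank.\<close>

lemma rank_Un_eqI:
  assumes "\<And>x. x \<in> B \<Longrightarrow> r (insert x A) = r A"
  shows "r (A \<union> B) = r A"
proof -
  obtain I where I: "I \<in> indep M" "I \<subseteq> A" "card I = r A" by (rule basis_exists)
  obtain K where K: "K \<in> indep M" "I \<subseteq> K" "K \<subseteq> A \<union> B" "card K = r (A \<union> B)"
    using extend_basis[of I "A \<union> B"] I by auto
  have "K \<subseteq> I"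
  proof
    fix x assume "x \<in> K"
    show "x \<in> I"
    proof (rule ccontr)
      assume "x \<notin> I"
      have "insert x I \<in> indep M" using K \<open>x \<in> K\<close> indep_mono[OF K(1)] by auto
      then have "card (insert x I) \<le> r (insert x A)" using I by (intro card_le_rank) auto
      moreover have "r (insert x A) = r A"
        using assms[of x] \<open>x \<in> K\<close> K by (cases "x \<in> A") (auto simp: insert_absorb)
      ultimately show False using I \<open>x \<notin> I\<close> finite_indep[of I] by simp
    qed
  qed
  then have "K = I" using K by auto
  with I K show ?thesis by simp
qed

lemma mem_cl_iff: "x \<in> cl M A \<longleftrightarrow> x \<in> E \<and> r (insert x A) = r A"
  by (simp add: cl_def)

lemma cl_subset_ground: "cl M A \<subseteq> E"
  by (auto simp: cl_def)

lemma cl_superset: "A \<subseteq> E \<Longrightarrow> A \<subseteq> cl M A"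
  by (auto simp: cl_def insert_absorb)

lemma rank_Un_cl: "r (A \<union> cl M A) = r A"
  by (rule rank_Un_eqI) (simp add: mem_cl_iff)

lemma rank_cl: "A \<subseteq> E \<Longrightarrow> r (cl M A) = r A"
  using rank_Un_cl[of A] cl_superset[of A] by (simp add: Un_absorb1)

lemma mem_clI: "x \<in> E \<Longrightarrow> A \<subseteq> B \<Longrightarrow> x \<in> B \<Longrightarrow> r B \<le> r A \<Longrightarrow> x \<in> cl M A"
  using rank_mono[OF subset_insertI[of A x]] rank_mono[of "insert x A" B]
  by (simp add: mem_cl_iff)

lemma cl_mono:
  assumes "A \<subseteq> B"
  shows "cl M A \<subseteq> cl M B"
proof
  fix x assume x: "x \<in> cl M A"
  have "r (insert x B) + r A \<le> r (insert x A) + r B"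
    using assms by (intro rank_submodular_le) auto
  then show "x \<in> cl M B" using x rank_mono[of B "insert x B"]
    by (simp add: mem_cl_iff subset_insertI)
qed

lemma cl_flat: "A \<subseteq> E \<Longrightarrow> cl M A \<in> L"
proof -
  assume A: "A \<subseteq> E"
  have "cl M (cl M A) \<subseteq> cl M A"
  proof
    fix x assume x: "x \<in> cl M (cl M A)"
    then have "r (insert x (cl M A)) = r A" using rank_cl[OF A] by (auto simp: mem_cl_iff)
    then show "x \<in> cl M A" using x cl_superset[OF A]
      by (intro mem_clI[of x A "insert x (cl M A)"]) (auto simp: mem_cl_iff)
  qed
  then show ?thesis using cl_superset[OF cl_subset_ground[of A]] cl_subset_ground[of A]
    by (auto simp: flats_def)
qed

lemma flat_subset: "F \<in> L \<Longrightarrow> F \<subseteq> E"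
  by (simp add: flats_def)

lemma flat_cl: "F \<in> L \<Longrightarrow> cl M F = F"
  by (simp add: flats_def)

lemma finite_flat: "F \<in> L \<Longrightarrow> finite F"
  using flat_subset finite_ground finite_subset by blast

lemma finite_flats [simp]: "finite L"
  by (rule finite_subset[of _ "Pow E"]) (use flat_subset finite_ground in auto)

lemma ground_flat: "E \<in> L"
  using cl_superset[of E] cl_subset_ground[of E] by (auto simp: flats_def)

lemma flat_Int: "F \<in> L \<Longrightarrow> G \<in> L \<Longrightarrow> F \<inter> G \<in> L"
  using cl_mono[of "F \<inter> G" F] cl_mono[of "F \<inter> G" G] cl_superset[of "F \<inter> G"]
  by (auto simp: flats_def)

lemma cl_least: "F \<in> L \<Longrightarrow> A \<subseteq> F \<Longrightarrow> cl M A \<subseteq> F"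
  using cl_mono[of A F] by (simp add: flats_def)

lemma cl_subset_iff: "F \<in> L \<Longrightarrow> A \<subseteq> E \<Longrightarrow> cl M A \<subseteq> F \<longleftrightarrow> A \<subseteq> F"
  using cl_least cl_superset by blast

lemma flat_eqI:
  assumes "F \<in> L" "G \<in> L" "F \<subseteq> G" "r G \<le> r F"
  shows "F = G"
proof -
  have "x \<in> cl M F" if "x \<in> G" for x
    using assms that flat_subset[of G] by (intro mem_clI[of x F G]) auto
  then show ?thesis using assms flat_cl by auto
qed

lemma rank_insert_flat: "F \<in> L \<Longrightarrow> x \<in> E \<Longrightarrow> x \<notin> F \<Longrightarrow> r (insert x F) = Suc (r F)"
  using rank_insert_cases[of x F] by (auto simp: flats_def mem_cl_iff)

lemma rank_cl_Un: "A \<subseteq> E \<Longrightarrow> B \<subseteq> E \<Longrightarrow> r (cl M A \<union> B) = r (A \<union> B)"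
proof -
  assume A: "A \<subseteq> E" and B: "B \<subseteq> E"
  have "cl M A \<union> B \<subseteq> cl M (A \<union> B)"
    using cl_mono[of A "A \<union> B"] cl_superset[of "A \<union> B"] A B by auto
  then show ?thesis using rank_mono[of "cl M A \<union> B" "cl M (A \<union> B)"] rank_cl[of "A \<union> B"]
    rank_mono[of "A \<union> B" "cl M A \<union> B"] cl_superset[of A] A B by fastforce
qed

end

section \<open>Modular flats and intervals of flats\<close>

text \<open>Modularity of \<open>A\<close> in the restriction to \<open>T\<close>, expressed inside
  \<open>M\<close> so that the upper end can vary. Ranks of unions stand for ranks of joins, which
  are equal.\<close>

definition modular_in :: "'a matroid_data \<Rightarrow> 'a set \<Rightarrow> 'a set \<Rightarrow> bool" where
  "modular_in M A T \<longleftrightarrow> A \<in> flats M \<and> A \<subseteq> T \<and>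
    (\<forall>Y \<in> flats M. Y \<subseteq> T \<longrightarrow> mrank M A + mrank M Y = mrank M (A \<inter> Y) + mrank M (A \<union> Y))"

text \<open>For flats \<open>Y \<subseteq> T\<close> this is the lattice of flats of the restriction
  to \<open>T\<close> contracted by \<open>Y\<close>, up to removing \<open>Y\<close> from each
  member.\<close>

definition flat_interval :: "'a matroid_data \<Rightarrow> 'a set \<Rightarrow> 'a set \<Rightarrow> 'a set set" where
  "flat_interval M Y T = {F \<in> flats M. Y \<subseteq> F \<and> F \<subseteq> T}"

lemma mem_flat_interval [simp]:
  "F \<in> flat_interval M Y T \<longleftrightarrow> F \<in> flats M \<and> Y \<subseteq> F \<and> F \<subseteq> T"
  by (simp add: flat_interval_def)

context matroid
begin

lemma finite_flat_interval [simp]: "finite (flat_interval M Y T)"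
  by (simp add: flat_interval_def)

lemma modular_inD:
  "modular_in M A T \<Longrightarrow> Y \<in> L \<Longrightarrow> Y \<subseteq> T \<Longrightarrow> r A + r Y = r (A \<inter> Y) + r (A \<union> Y)"
  by (simp add: modular_in_def)

lemma modular_in_flat: "modular_in M A T \<Longrightarrow> A \<in> L"
  and modular_in_subset: "modular_in M A T \<Longrightarrow> A \<subseteq> T"
  by (simp_all add: modular_in_def)

lemma modular_in_mono: "modular_in M A T \<Longrightarrow> A \<subseteq> S \<Longrightarrow> S \<subseteq> T \<Longrightarrow> modular_in M A S"
  by (auto simp: modular_in_def)

lemma modular_flat_imp_modular_in: "modular_flat M A \<Longrightarrow> modular_in M A E"
  unfolding modular_flat_def modular_in_def
  by (metis Un_least flat_subset rank_cl)

lemma flat_join: "F \<in> L \<Longrightarrow> G \<in> L \<Longrightarrow> cl M (F \<union> G) \<in> L"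
  by (simp add: cl_flat flat_subset)

lemma flat_join_le: "F \<in> L \<Longrightarrow> G \<in> L \<Longrightarrow> H \<in> L \<Longrightarrow>
    cl M (F \<union> G) \<subseteq> H \<longleftrightarrow> F \<subseteq> H \<and> G \<subseteq> H"
  by (simp add: cl_subset_iff flat_subset)

lemma flat_join_upper: "F \<in> L \<Longrightarrow> G \<in> L \<Longrightarrow> F \<subseteq> cl M (F \<union> G) \<and> G \<subseteq> cl M (F \<union> G)"
  using cl_superset[of "F \<union> G"] flat_subset by auto

lemma rank_join: "F \<in> L \<Longrightarrow> G \<in> L \<Longrightarrow> r (cl M (F \<union> G)) = r (F \<union> G)"
  by (simp add: rank_cl flat_subset)

lemma rank_between_cl: "A \<subseteq> E \<Longrightarrow> A \<subseteq> B \<Longrightarrow> B \<subseteq> cl M A \<Longrightarrow> r B = r A"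
  using rank_mono[of A B] rank_mono[of B "cl M A"] rank_cl[of A] by simp

text \<open>Let \<open>G\<close> be the join of \<open>F\<close> and \<open>Y\<close>. Both
  \<open>G\<close> and \<open>Y\<close> have the same join with \<open>A\<close>, so modularity
  gives \<open>r G - r (A \<inter> G) = r Y - r (A \<inter> Y)\<close>. Submodularity bounds
  \<open>r G\<close> from above, which leaves \<open>A \<inter> G\<close> no more rank than its
  subflat \<open>F\<close>.\<close>

lemma perspectivity_Int:
  assumes A: "modular_in M A T" and T: "T \<in> L" and Y: "Y \<in> L" "Y \<subseteq> T"
    and F: "F \<in> L" "A \<inter> Y \<subseteq> F" "F \<subseteq> A"
  shows "cl M (F \<union> Y) \<inter> A = F" and "r (F \<union> Y) + r (A \<inter> Y) = r F + r Y"
proof -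
  define G where "G = cl M (F \<union> Y)"
  note A' = modular_in_flat[OF A] modular_in_subset[OF A]
  have G: "G \<in> L" "F \<subseteq> G" "Y \<subseteq> G" "G \<subseteq> T"
    using F Y A' flat_join[OF F(1) Y(1)] flat_join_upper[OF F(1) Y(1)] flat_join_le[OF F(1) Y(1) T]
    unfolding G_def by auto
  have "r (A \<union> G) = r (A \<union> Y)"
  proof (rule rank_between_cl)
    show "A \<union> G \<subseteq> cl M (A \<union> Y)"
      using cl_mono[of "F \<union> Y" "A \<union> Y"] F A' Y flat_join_upper[of A Y] by (auto simp: G_def)
  qed (use A' Y G flat_subset in auto)
  moreover have "r A + r G = r (A \<inter> G) + r (A \<union> G)" "r A + r Y = r (A \<inter> Y) + r (A \<union> Y)"
    using modular_inD[OF A] G Y by auto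
  moreover have "r (F \<union> Y) + r (A \<inter> Y) \<le> r F + r Y"
    using F by (intro rank_submodular_le) auto
  moreover have "r G = r (F \<union> Y)" using F Y by (simp add: G_def rank_join)
  moreover have "r F \<le> r (A \<inter> G)" using F G by (intro rank_mono) auto
  ultimately have "r (A \<inter> G) = r F" "r (F \<union> Y) + r (A \<inter> Y) = r F + r Y" by linarith+
  then show "r (F \<union> Y) + r (A \<inter> Y) = r F + r Y" "cl M (F \<union> Y) \<inter> A = F"
    using flat_eqI[of F "A \<inter> G"] F G A' flat_Int[of A G] by (auto simp: G_def)
qed

text \<open>The flat spanned by \<open>G \<inter> A\<close> and \<open>Y\<close> lies below
  \<open>G\<close> and has the same meet and the same join with \<open>A\<close>; by modularity it
  has the rank of \<open>G\<close>.\<close>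

lemma perspectivity_Un:
  assumes A: "modular_in M A T" and T: "T \<in> L" and Y: "Y \<in> L" "Y \<subseteq> T"
    and G: "G \<in> L" "Y \<subseteq> G" "G \<subseteq> cl M (A \<union> Y)"
  shows "cl M ((G \<inter> A) \<union> Y) = G"
proof -
  define H where "H = cl M ((G \<inter> A) \<union> Y)"
  note A' = modular_in_flat[OF A] modular_in_subset[OF A]
  have GA: "G \<inter> A \<in> L" using G A' flat_Int by blast
  have H: "H \<in> L" "Y \<subseteq> H" "G \<inter> A \<subseteq> H" "H \<subseteq> G"
    using G flat_join[OF GA Y(1)] flat_join_upper[OF GA Y(1)] flat_join_le[OF GA Y(1) G(1)]
    unfolding H_def by auto
  have GT: "G \<subseteq> T" using G(3) A' Y flat_join_le[OF A'(1) Y(1) T] by simp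
  have eq: "r (A \<union> K) = r (A \<union> Y)" if "Y \<subseteq> K" "K \<subseteq> G" for K
  proof (rule rank_between_cl)
    show "A \<union> Y \<subseteq> E" using A' Y flat_subset by auto
    show "A \<union> Y \<subseteq> A \<union> K" using that by auto
    show "A \<union> K \<subseteq> cl M (A \<union> Y)"
      using that G(3) flat_join_upper[OF A'(1) Y(1)] by auto
  qed
  have "r (A \<union> G) = r (A \<union> Y)" "r (A \<union> H) = r (A \<union> Y)"
    using eq[OF G(2)] eq[OF H(2,4)] by simp_all
  moreover have "r A + r G = r (A \<inter> G) + r (A \<union> G)" "r A + r H = r (A \<inter> H) + r (A \<union> H)"
    using modular_inD[OF A] G H GT by auto
  moreover have "A \<inter> H = A \<inter> G" using H by auto
  ultimately have "r G = r H" by simp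
  then show ?thesis using flat_eqI[of H G] H G by (simp add: H_def)
qed

text \<open>The upper end \<open>F\<close> is arbitrary, not just \<open>A\<close>, because Moebius
  values are transported through their partial sums over all lower intervals.\<close>

lemma perspectivity_bij:
  assumes A: "modular_in M A T" and T: "T \<in> L" and Y: "Y \<in> L" "Y \<subseteq> T"
    and F: "F \<in> L" "A \<inter> Y \<subseteq> F" "F \<subseteq> A"
  shows "bij_betw (\<lambda>K. cl M (K \<union> Y)) (flat_interval M (A \<inter> Y) F)
           (flat_interval M Y (cl M (F \<union> Y)))"
proof (rule bij_betw_byWitness[where f' = "\<lambda>G. G \<inter> A"])
  note A' = modular_in_flat[OF A] modular_in_subset[OF A]
  have "cl M (F \<union> Y) \<subseteq> cl M (A \<union> Y)" using F by (intro cl_mono) auto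
  then show "\<forall>G\<in>flat_interval M Y (cl M (F \<union> Y)). cl M (G \<inter> A \<union> Y) = G"
    using perspectivity_Un[OF A T Y] by auto
  show "\<forall>K\<in>flat_interval M (A \<inter> Y) F. cl M (K \<union> Y) \<inter> A = K"
    using perspectivity_Int(1)[OF A T Y] F by (meson mem_flat_interval subset_trans)
  show "(\<lambda>K. cl M (K \<union> Y)) ` flat_interval M (A \<inter> Y) F
      \<subseteq> flat_interval M Y (cl M (F \<union> Y))"
  proof safe
    fix K assume K: "K \<in> flat_interval M (A \<inter> Y) F"
    then have "cl M (K \<union> Y) \<subseteq> cl M (F \<union> Y)" by (intro cl_mono) auto
    then show "cl M (K \<union> Y) \<in> flat_interval M Y (cl M (F \<union> Y))"
      using K Y flat_join[of K Y] flat_join_upper[of K Y] by simp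
  qed
  show "(\<lambda>G. G \<inter> A) ` flat_interval M Y (cl M (F \<union> Y)) \<subseteq> flat_interval M (A \<inter> Y) F"
    using A' flat_Int perspectivity_Int(1)[OF A T Y F] by fastforce
qed

text \<open>Modularity of \<open>A\<close> is applied to \<open>W\<close> and to the join
  \<open>G\<close> of \<open>A \<inter> B\<close> with \<open>W\<close>. The unions with
  \<open>A\<close> have equal rank and \<open>A \<inter> G = A \<inter> B\<close>, so the difference
  of the two equations is the claim.\<close>

lemma modular_in_Int:
  assumes A: "modular_in M A T" and B: "B \<in> L" "B \<subseteq> T"
  shows "modular_in M (A \<inter> B) B"
  unfolding modular_in_def
proof (intro conjI ballI impI)
  note A' = modular_in_flat[OF A] modular_in_subset[OF A]
  show AB: "A \<inter> B \<in> L" using A' B flat_Int by blast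
  fix W assume W: "W \<in> L" "W \<subseteq> B"
  define G where "G = cl M ((A \<inter> B) \<union> W)"
  have G: "G \<in> L" "A \<inter> B \<subseteq> G" "W \<subseteq> G" "G \<subseteq> B"
    using W flat_join[OF AB W(1)] flat_join_upper[OF AB W(1)] flat_join_le[OF AB W(1) B(1)]
    unfolding G_def by auto
  have "A \<inter> B \<union> W \<subseteq> E" "A \<subseteq> E" using A' W flat_subset by auto
  from rank_cl_Un[OF this] have "r (A \<union> G) = r (A \<union> W)"
    by (simp add: G_def Un_commute[of _ A] Un_assoc[symmetric])
  moreover have "r A + r G = r (A \<inter> G) + r (A \<union> G)" "r A + r W = r (A \<inter> W) + r (A \<union> W)"
    using modular_inD[OF A] G W B by auto
  moreover have "A \<inter> G = A \<inter> B" "A \<inter> B \<inter> W = A \<inter> W" using G W by auto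
  moreover have "r G = r ((A \<inter> B) \<union> W)" using \<open>A \<inter> B \<in> L\<close> W by (simp add: G_def rank_join)
  ultimately show "r (A \<inter> B) + r W = r (A \<inter> B \<inter> W) + r (A \<inter> B \<union> W)" by simp
qed auto

end

section \<open>Characteristic polynomials of intervals\<close>

text \<open>As in \<open>moebius\<close>, the condition \<open>finite F\<close> only serves termination.\<close>

function interval_moebius :: "'a matroid_data \<Rightarrow> 'a set \<Rightarrow> 'a set \<Rightarrow> int" where
  "interval_moebius M Y F =
    (if F = Y then 1
     else - (\<Sum>Z \<in> {Z \<in> flats M. finite F \<and> Y \<subseteq> Z \<and> Z \<subset> F}. interval_moebius M Y Z))"
  by pat_completeness auto
termination
proof (relation "inv_image finite_psubset (snd \<circ> snd)")
  show "wf (inv_image finite_psubset (snd \<circ> snd :: 'a matroid_data \<times> 'a set \<times> 'a set \<Rightarrow> 'a set))"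
    by simp
qed (simp add: finite_psubset_def)

declare interval_moebius.simps [simp del]

text \<open>For flats \<open>Y \<subseteq> T\<close>, the characteristic polynomial of the
  restriction to \<open>T\<close> contracted by \<open>Y\<close>; in the exponent the two shifts by
  \<open>mrank M Y\<close> cancel.\<close>

definition interval_charpoly :: "'a matroid_data \<Rightarrow> 'a set \<Rightarrow> 'a set \<Rightarrow> int poly" where
  "interval_charpoly M Y T =
    (\<Sum>F \<in> flat_interval M Y T. monom (interval_moebius M Y F) (mrank M T - mrank M F))"

context matroid
begin

abbreviation \<mu> where "\<mu> \<equiv> interval_moebius M"
abbreviation \<chi> where "\<chi> \<equiv> interval_charpoly M"

lemma moebius_bottom [simp]: "\<mu> Y Y = 1"
  by (simp add: interval_moebius.simps)

lemma flat_interval_remove_top: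
  assumes "F \<in> L" "Y \<subseteq> F"
  shows "flat_interval M Y F = insert F {Z \<in> L. finite F \<and> Y \<subseteq> Z \<and> Z \<subset> F}"
  using assms finite_flat by auto

lemma sum_moebius:
  assumes "F \<in> L" "Y \<subseteq> F"
  shows "(\<Sum>Z \<in> flat_interval M Y F. \<mu> Y Z) = (if F = Y then 1 else 0)"
proof (cases "F = Y")
  case True
  then have "flat_interval M Y F = {Y}" using assms by auto
  then show ?thesis using True by simp
next
  case False
  then have "\<mu> Y F = - (\<Sum>Z \<in> {Z \<in> L. finite F \<and> Y \<subseteq> Z \<and> Z \<subset> F}. \<mu> Y Z)"
    by (subst interval_moebius.simps) simp
  then show ?thesis using False by (simp add: flat_interval_remove_top[OF assms])
qed

text \<open>Partial sums determine a function on the interval, since cancelling the terms strictly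
  below \<open>F\<close> leaves the value at \<open>F\<close>. This is how Moebius values are
  computed below.\<close>

lemma moebius_unique:
  assumes \<nu>: "\<And>F. F \<in> flat_interval M Y T \<Longrightarrow>
      (\<Sum>Z \<in> flat_interval M Y F. \<nu> Z) = (if F = Y then 1 else (0::int))"
    and F: "F \<in> flat_interval M Y T"
  shows "\<nu> F = \<mu> Y F"
proof -
  have "finite F" using F finite_flat by auto
  then show ?thesis using F
  proof (induction F rule: finite_psubset_induct)
    case (psubset F)
    let ?S = "{Z \<in> L. finite F \<and> Y \<subseteq> Z \<and> Z \<subset> F}"
    have F: "F \<in> L" "Y \<subseteq> F" using psubset.prems by auto
    have "sum \<nu> (flat_interval M Y F) = sum (\<mu> Y) (flat_interval M Y F)"
      using \<nu>[OF psubset.prems] sum_moebius[OF F] by simp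
    moreover have "sum \<nu> ?S = sum (\<mu> Y) ?S"
    proof (intro sum.cong refl)
      fix Z assume "Z \<in> ?S"
      then have "Z \<subset> F" "Z \<in> flat_interval M Y T" using psubset.prems by auto
      then show "\<nu> Z = \<mu> Y Z" by (rule psubset.IH)
    qed
    ultimately show ?case by (simp add: flat_interval_remove_top[OF F])
  qed
qed

lemma moebius_perspectivity:
  assumes A: "modular_in M A T" and T: "T \<in> L" and Y: "Y \<in> L" "Y \<subseteq> T"
    and F: "F \<in> L" "A \<inter> Y \<subseteq> F" "F \<subseteq> A"
  shows "\<mu> Y (cl M (F \<union> Y)) = \<mu> (A \<inter> Y) F"
proof (rule moebius_unique[where T = A])
  fix K assume K: "K \<in> flat_interval M (A \<inter> Y) A"
  have "(\<Sum>Z \<in> flat_interval M (A \<inter> Y) K. \<mu> Y (cl M (Z \<union> Y)))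
      = (\<Sum>Z \<in> flat_interval M Y (cl M (K \<union> Y)). \<mu> Y Z)"
    using perspectivity_bij[OF A T Y, of K] K
    by (intro sum.reindex_bij_betw) auto
  also have "\<dots> = (if cl M (K \<union> Y) = Y then 1 else 0)"
    using K Y flat_join flat_join_upper by (intro sum_moebius) auto
  also have "cl M (K \<union> Y) = Y \<longleftrightarrow> K = A \<inter> Y"
  proof
    assume "cl M (K \<union> Y) = Y"
    then show "K = A \<inter> Y" using perspectivity_Int(1)[OF A T Y, of K] K by auto
  next
    assume "K = A \<inter> Y"
    then have "K \<union> Y = Y" by auto
    then show "cl M (K \<union> Y) = Y" using flat_cl[OF Y(1)] by simp
  qed
  finally show "(\<Sum>Z \<in> flat_interval M (A \<inter> Y) K. \<mu> Y (cl M (Z \<union> Y)))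
      = (if K = A \<inter> Y then 1 else 0)" .
qed (use F in auto)

text \<open>The diamond isomorphism keeps Moebius values, and modularity makes coranks agree:
  \<open>r T - r (F \<union> Y) = r A - r F\<close>.\<close>

lemma charpoly_perspectivity:
  assumes A: "modular_in M A T" and T: "T \<in> L" and Y: "Y \<in> L" "Y \<subseteq> T"
    and AY: "cl M (A \<union> Y) = T"
  shows "\<chi> Y T = \<chi> (A \<inter> Y) A"
proof -
  note A' = modular_in_flat[OF A] modular_in_subset[OF A]
  have "\<chi> (A \<inter> Y) A = (\<Sum>F \<in> flat_interval M (A \<inter> Y) A.
      monom (\<mu> Y (cl M (F \<union> Y))) (r T - r (cl M (F \<union> Y))))"
    unfolding interval_charpoly_def
  proof (intro sum.cong refl)
    fix F assume "F \<in> flat_interval M (A \<inter> Y) A"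
    then have F: "F \<in> L" "A \<inter> Y \<subseteq> F" "F \<subseteq> A" by auto
    have "r T = r (A \<union> Y)" using AY rank_join[of A Y] A' Y by simp
    then have "r T - r (cl M (F \<union> Y)) = r A - r F"
      using perspectivity_Int(2)[OF A T Y F] modular_inD[OF A Y] F Y rank_join[of F Y] by simp
    then show "monom (\<mu> (A \<inter> Y) F) (r A - r F)
        = monom (\<mu> Y (cl M (F \<union> Y))) (r T - r (cl M (F \<union> Y)))"
      using moebius_perspectivity[OF A T Y F] by simp
  qed
  also have "\<dots> = \<chi> Y T"
    unfolding interval_charpoly_def
    using perspectivity_bij[OF A T Y, of A] A' AY by (intro sum.reindex_bij_betw) auto
  finally show ?thesis ..
qed

end

section \<open>Modular factorization and its complementary factor\<close>

context matroid
begin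

text \<open>Both sides have the same partial sums over the flats of \<open>[Y, F]\<close>: a join \<open>A' \<or> Z\<close> lies
  below \<open>F\<close> iff \<open>A'\<close> and \<open>Z\<close> do, so the partial sum of the left-hand side is a product.\<close>

lemma moebius_modular_convolution:
  assumes A: "modular_in M A T" and Y: "Y \<in> L" "Y \<subseteq> A"
    and F: "F \<in> flat_interval M Y T"
  shows "(\<Sum>p | p \<in> flat_interval M Y A \<times> {Z \<in> flat_interval M Y T. Z \<inter> A = Y} \<and>
      cl M (fst p \<union> snd p) = F. \<mu> Y (fst p) * \<mu> Y (snd p)) = \<mu> Y F"
  (is "?\<nu> F = _")
proof (rule moebius_unique[where T = T])
  note A' = modular_in_flat[OF A] modular_in_subset[OF A]
  let ?U = "flat_interval M Y A \<times> {Z \<in> flat_interval M Y T. Z \<inter> A = Y}"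
  let ?g = "\<lambda>p. \<mu> Y (fst p) * \<mu> Y (snd p)"
  fix F assume "F \<in> flat_interval M Y T"
  then have F: "F \<in> L" "Y \<subseteq> F" "F \<subseteq> T" by auto
  let ?Z = "{Z \<in> flat_interval M Y F. Z \<inter> A = Y}"
  have join_le: "cl M (fst p \<union> snd p) \<subseteq> F \<longleftrightarrow> fst p \<subseteq> F \<and> snd p \<subseteq> F" if "p \<in> ?U" for p
  proof -
    have "fst p \<in> L" "snd p \<in> L" using that by auto
    then show ?thesis by (rule flat_join_le[OF _ _ F(1)])
  qed
  have S: "flat_interval M Y (A \<inter> F) \<times> ?Z = {p \<in> ?U. cl M (fst p \<union> snd p) \<subseteq> F}"
    (is "?S = _")
  proof (rule set_eqI)
    fix p
    have "p \<in> ?S \<longleftrightarrow> p \<in> ?U \<and> fst p \<subseteq> F \<and> snd p \<subseteq> F" using F(3) by (cases p) auto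
    then show "p \<in> ?S \<longleftrightarrow> p \<in> {p \<in> ?U. cl M (fst p \<union> snd p) \<subseteq> F}"
      using join_le[of p] by blast
  qed
  have "(\<Sum>G \<in> flat_interval M Y F. ?\<nu> G)
      = (\<Sum>G \<in> flat_interval M Y F. sum ?g {p. p \<in> ?S \<and> cl M (fst p \<union> snd p) = G})"
    unfolding S by (intro sum.cong refl arg_cong[where f = "sum ?g"]) auto
  also have "\<dots> = sum ?g ?S"
  proof (rule sum.group)
    show "(\<lambda>p. cl M (fst p \<union> snd p)) ` ?S \<subseteq> flat_interval M Y F"
    proof (rule image_subsetI)
      fix p assume "p \<in> ?S"
      then show "cl M (fst p \<union> snd p) \<in> flat_interval M Y F"
        using flat_join[of "fst p" "snd p"] flat_join_upper[of "fst p" "snd p"]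
          flat_join_le[of "fst p" "snd p" F] F by (cases p) auto
    qed
  qed auto
  also have "\<dots> = sum (\<mu> Y) (flat_interval M Y (A \<inter> F)) * sum (\<mu> Y) ?Z"
    by (simp add: sum_product sum.cartesian_product case_prod_beta)
  also have "\<dots> = (if F = Y then 1 else 0)"
  \<comment> \<open>If \<open>A \<inter> F = Y\<close>, the first factor is 1 and every
    \<open>Z\<close> of \<open>[Y, F]\<close> satisfies \<open>Z \<inter> A = Y\<close>, so the
    second is a full Moebius sum. Otherwise the first factor is a vanishing Moebius sum.\<close>
  proof (cases "A \<inter> F = Y")
    case True
    then have "?Z = flat_interval M Y F" using Y by auto
    then show ?thesis using sum_moebius[OF F(1,2)] True sum_moebius[of Y Y] Y by simp
  next
    case False
    then have "F \<noteq> Y" using Y by auto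
    moreover have "sum (\<mu> Y) (flat_interval M Y (A \<inter> F)) = 0"
      using sum_moebius[of "A \<inter> F" Y] False F Y A' flat_Int by simp
    ultimately show ?thesis by simp
  qed
  finally show "(\<Sum>G \<in> flat_interval M Y F. ?\<nu> G) = (if F = Y then 1 else 0)" .
qed (rule F)

text \<open>The exponent is the corank in \<open>T\<close> of the join of \<open>A\<close> and
  \<open>Z\<close>: when \<open>A\<close> is modular and \<open>Z \<inter> A = Y\<close>, that join
  has rank \<open>r A + r Z - r Y\<close>.\<close>

definition complement_poly :: "'a set \<Rightarrow> 'a set \<Rightarrow> 'a set \<Rightarrow> int poly" where
  "complement_poly A Y T =
    (\<Sum>Z \<in> {Z \<in> flat_interval M Y T. Z \<inter> A = Y}. monom (\<mu> Y Z) (r T + r Y - r A - r Z))"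

text \<open>Stanley's modular factorization theorem.\<close>

lemma charpoly_modular_factor:
  assumes A: "modular_in M A T" and T: "T \<in> L" and Y: "Y \<in> L" "Y \<subseteq> A"
  shows "\<chi> Y T = \<chi> Y A * complement_poly A Y T"
proof -
  note A' = modular_in_flat[OF A] modular_in_subset[OF A]
  let ?Z = "{Z \<in> flat_interval M Y T. Z \<inter> A = Y}"
  let ?U = "flat_interval M Y A \<times> ?Z"
  let ?j = "\<lambda>p. cl M (fst p \<union> snd p)"
  let ?h = "\<lambda>p. monom (\<mu> Y (fst p) * \<mu> Y (snd p)) (r T - r (?j p))"
  have "\<chi> Y T = (\<Sum>F \<in> flat_interval M Y T. sum ?h {p. p \<in> ?U \<and> ?j p = F})"
    unfolding interval_charpoly_def
  proof (intro sum.cong refl)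
    fix F assume F: "F \<in> flat_interval M Y T"
    have "sum ?h {p. p \<in> ?U \<and> ?j p = F}
        = (\<Sum>p | p \<in> ?U \<and> ?j p = F. monom (\<mu> Y (fst p) * \<mu> Y (snd p)) (r T - r F))"
      by (intro sum.cong refl) auto
    also have "\<dots> = monom (\<mu> Y F) (r T - r F)"
      by (subst moebius_modular_convolution[OF A Y F, symmetric]) (simp add: monom_sum)
    finally show "monom (\<mu> Y F) (r T - r F) = sum ?h {p. p \<in> ?U \<and> ?j p = F}" ..
  qed
  also have "\<dots> = sum ?h ?U"
  proof (rule sum.group)
    show "?j ` ?U \<subseteq> flat_interval M Y T"
    proof (rule image_subsetI)
      fix p assume "p \<in> ?U"
      then show "?j p \<in> flat_interval M Y T"
        using flat_join[of "fst p" "snd p"] flat_join_upper[of "fst p" "snd p"]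
          flat_join_le[of "fst p" "snd p" T] T A' by (cases p) auto
    qed
  qed auto
  also have "\<dots> = (\<Sum>p \<in> ?U. monom (\<mu> Y (fst p)) (r A - r (fst p)) *
      monom (\<mu> Y (snd p)) (r T + r Y - r A - r (snd p)))"
  proof (intro sum.cong refl)
    fix p assume pU: "p \<in> ?U"
    obtain B Z where p: "p = (B, Z)" by (cases p)
    have B: "B \<in> L" "Y \<subseteq> B" "B \<subseteq> A" and Z: "Z \<in> L" "Y \<subseteq> Z" "Z \<subseteq> T" "Z \<inter> A = Y"
      using pU unfolding p by simp_all
    have AZ: "A \<inter> Z = Y" using Z(4) by (simp add: Int_commute)
    \<comment> \<open>The corank of \<open>B \<or> Z\<close> in \<open>T\<close> splits into the
      corank of \<open>B\<close> in \<open>A\<close> and that of \<open>A \<or> Z\<close> in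
      \<open>T\<close>. The two inequalities ensure that no natural subtraction is
      truncated.\<close>
    have "r (B \<union> Z) + r Y = r B + r Z"
      using perspectivity_Int(2)[OF A T Z(1,3) B(1) _ B(3)] B AZ by simp
    moreover have "r A + r Z = r Y + r (A \<union> Z)" using modular_inD[OF A Z(1,3)] AZ by simp
    moreover have "r (A \<union> Z) \<le> r T" "r B \<le> r A" using A' B Z by (auto intro!: rank_mono)
    moreover have "r (cl M (B \<union> Z)) = r (B \<union> Z)" using B Z by (simp add: rank_join)
    ultimately have "r T - r (cl M (B \<union> Z)) = (r A - r B) + (r T + r Y - r A - r Z)"
      by linarith
    then show "?h p = monom (\<mu> Y (fst p)) (r A - r (fst p)) *
      monom (\<mu> Y (snd p)) (r T + r Y - r A - r (snd p))"
      by (simp add: p mult_monom)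
  qed
  also have "\<dots> = \<chi> Y A * complement_poly A Y T"
    by (simp add: interval_charpoly_def complement_poly_def sum_product sum.cartesian_product
        case_prod_beta)
  finally show ?thesis .
qed

text \<open>As \<open>T = A \<union> B\<close>, a flat \<open>Z\<close> with
  \<open>Z \<inter> A = Y\<close> consists of \<open>Y\<close> and \<open>Z \<inter> B\<close>.
  Perspectivity along the modular flat \<open>B\<close> matches these \<open>Z\<close> with the
  flats \<open>W\<close> of \<open>B\<close> that miss \<open>A\<close>; because \<open>Y\<close>
  misses \<open>B\<close>, Moebius values are kept and ranks shift by \<open>r Y\<close>, which the
  exponent compensates.\<close>

lemma complement_poly_join:
  assumes A: "modular_in M A T" and B: "modular_in M B T" and T: "T \<in> L" "T = A \<union> B"
    and Y: "Y \<in> L" "Y \<subseteq> A" "Y \<inter> B = {}" and bot: "{} \<in> L"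
  shows "complement_poly A Y T = complement_poly A {} T"
proof -
  note A' = modular_in_flat[OF A] modular_in_subset[OF A]
  note B' = modular_in_flat[OF B] modular_in_subset[OF B]
  let ?W = "{W \<in> flat_interval M {} T. W \<inter> A = {}}"
  let ?Z = "{Z \<in> flat_interval M Y T. Z \<inter> A = Y}"
  have YT: "Y \<subseteq> T" and BY: "B \<inter> Y = {}" using Y T by auto
  have Int_B: "cl M (W \<union> Y) \<inter> B = W" and rank: "r (cl M (W \<union> Y)) = r W + r Y"
    and mu: "\<mu> Y (cl M (W \<union> Y)) = \<mu> {} W" if "W \<in> ?W" for W
  proof -
    have W: "W \<in> L" "B \<inter> Y \<subseteq> W" "W \<subseteq> B" using that T BY by auto
    show "cl M (W \<union> Y) \<inter> B = W" "r (cl M (W \<union> Y)) = r W + r Y"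
      "\<mu> Y (cl M (W \<union> Y)) = \<mu> {} W"
      using perspectivity_Int[OF B T(1) Y(1) YT W] moebius_perspectivity[OF B T(1) Y(1) YT W]
        W Y BY by (simp_all add: rank_join)
  qed
  have "bij_betw (\<lambda>W. cl M (W \<union> Y)) ?W ?Z"
  proof (rule bij_betw_byWitness[where f' = "\<lambda>Z. Z \<inter> B"])
    show "\<forall>W \<in> ?W. cl M (W \<union> Y) \<inter> B = W" using Int_B by blast
    show "\<forall>Z \<in> ?Z. cl M (Z \<inter> B \<union> Y) = Z"
    proof
      fix Z assume Z: "Z \<in> ?Z"
      then have "Z \<subseteq> B \<union> Y" using T by auto
      then have "Z \<subseteq> cl M (B \<union> Y)" using flat_join_upper[OF B'(1) Y(1)] by auto
      then show "cl M (Z \<inter> B \<union> Y) = Z"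
        using perspectivity_Un[OF B T(1) Y(1) YT] Z by auto
    qed
    show "(\<lambda>W. cl M (W \<union> Y)) ` ?W \<subseteq> ?Z"
    proof safe
      fix W assume W: "W \<in> flat_interval M {} T" "W \<inter> A = {}"
      then have WL: "W \<in> L" "W \<subseteq> T" by auto
      then show "cl M (W \<union> Y) \<in> flat_interval M Y T"
        using flat_join[OF WL(1) Y(1)] flat_join_upper[OF WL(1) Y(1)]
          flat_join_le[OF WL(1) Y(1) T(1)] YT by auto
      \<comment> \<open>Here the modular flat is \<open>A\<close>, and the roles of the two joined
        flats are exchanged: \<open>Y\<close> is the flat below \<open>A\<close> and
        \<open>W\<close> the one outside.\<close>
      have eq: "cl M (W \<union> Y) \<inter> A = Y"
        using perspectivity_Int(1)[OF A T(1) WL Y(1) _ Y(2)] W(2)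
        by (simp add: Int_commute Un_commute)
      show "x \<in> Y" if "x \<in> cl M (W \<union> Y)" "x \<in> A" for x using eq that by auto
      show "x \<in> cl M (W \<union> Y)" if "x \<in> Y" for x using eq that by auto
      show "x \<in> A" if "x \<in> Y" for x using Y that by auto
    qed
    show "(\<lambda>Z. Z \<inter> B) ` ?Z \<subseteq> ?W" using B' Y flat_Int by auto
  qed
  then have "complement_poly A Y T
      = (\<Sum>W \<in> ?W. monom (\<mu> Y (cl M (W \<union> Y))) (r T + r Y - r A - r (cl M (W \<union> Y))))"
    unfolding complement_poly_def by (rule sum.reindex_bij_betw[symmetric])
  also have "\<dots> = complement_poly A {} T"
    unfolding complement_poly_def using rank mu by (intro sum.cong refl) simp
  finally show ?thesis .
qed

end

section \<open>Divisional paths\<close>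

text \<open>A relation rather than a sequence, so that paths can be concatenated and transported
  step by step. For \<open>T\<close> the ground set, a path from \<open>{}\<close> to
  \<open>T\<close> is a divisional flag.\<close>

definition charpoly_step :: "'a matroid_data \<Rightarrow> 'a set \<Rightarrow> ('a set \<times> 'a set) set" where
  "charpoly_step M T = {(A, B). A \<in> flats M \<and> B \<in> flats M \<and> A \<subseteq> B \<and> B \<subseteq> T \<and>
     mrank M B = Suc (mrank M A) \<and> interval_charpoly M B T dvd interval_charpoly M A T}"

context matroid
begin

lemma charpoly_path_flat:
  "(A, B) \<in> (charpoly_step M T)\<^sup>* \<Longrightarrow> A \<in> L \<Longrightarrow> A \<subseteq> T \<Longrightarrow> B \<in> L \<and> A \<subseteq> B \<and> B \<subseteq> T"
  by (induction rule: rtrancl_induct) (auto simp: charpoly_step_def)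

text \<open>Every flat on the path lies below its end and so misses \<open>B\<close> too. Hence each
  step has both its polynomials multiplied by the same factor
  \<open>complement_poly A {} T\<close>.\<close>

lemma charpoly_path_join:
  assumes A: "modular_in M A T" and B: "modular_in M B T" and T: "T \<in> L" "T = A \<union> B"
    and bot: "{} \<in> L"
    and path: "({}, Y) \<in> (charpoly_step M A)\<^sup>*" and "Y \<inter> B = {}"
  shows "({}, Y) \<in> (charpoly_step M T)\<^sup>*"
  using path \<open>Y \<inter> B = {}\<close>
proof (induction rule: rtrancl_induct)
  case (step Y Z)
  then have YZ: "Y \<in> L" "Z \<in> L" "Y \<subseteq> Z" "Z \<subseteq> A" "r Z = Suc (r Y)" "\<chi> Z A dvd \<chi> Y A"
    and disj: "Z \<inter> B = {}" "Y \<inter> B = {}"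
    by (auto simp: charpoly_step_def)
  have "\<chi> W T = \<chi> W A * complement_poly A {} T" if "W \<in> L" "W \<subseteq> A" "W \<inter> B = {}" for W
    using charpoly_modular_factor[OF A T(1)] complement_poly_join[OF A B T _ _ _ bot] that by simp
  then have "\<chi> Z T dvd \<chi> Y T" using YZ disj by (simp add: mult_dvd_mono)
  then have "(Y, Z) \<in> charpoly_step M T" using YZ T by (auto simp: charpoly_step_def)
  then show ?case using step.IH disj by (meson rtrancl.rtrancl_into_rtrancl)
qed simp

text \<open>For a flat \<open>W\<close> of \<open>A\<close>, the join \<open>W \<or> Y\<close> meets
  \<open>A\<close> in \<open>W\<close> and spans \<open>T\<close> together with \<open>A\<close>. So
  \<open>[W \<or> Y, T]\<close> has the polynomial of \<open>[W, A]\<close>, and ranks shift by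
  \<open>r Y\<close>.\<close>

lemma charpoly_path_perspectivity:
  assumes A: "modular_in M A T" and T: "T \<in> L" and Y: "Y \<in> L" "Y \<subseteq> T"
    and AY: "A \<inter> Y = {}" "cl M (A \<union> Y) = T"
    and path: "(F, Z) \<in> (charpoly_step M A)\<^sup>*"
  shows "(cl M (F \<union> Y), cl M (Z \<union> Y)) \<in> (charpoly_step M T)\<^sup>*"
  using path
proof (induction rule: rtrancl_induct)
  case (step Z Z')
  note A' = modular_in_flat[OF A] modular_in_subset[OF A]
  from step.hyps have Z: "Z \<in> L" "Z' \<in> L" "Z \<subseteq> Z'" "Z' \<subseteq> A" "Z \<subseteq> A" "r Z' = Suc (r Z)"
    "\<chi> Z' A dvd \<chi> Z A"
    by (auto simp: charpoly_step_def)
  have join: "cl M (W \<union> Y) \<in> L \<and> cl M (W \<union> Y) \<subseteq> T \<and> r (cl M (W \<union> Y)) = r W + r Y \<and>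
      \<chi> (cl M (W \<union> Y)) T = \<chi> W A" if W: "W \<in> L" "W \<subseteq> A" for W
  proof -
    have J: "cl M (W \<union> Y) \<in> L" "cl M (W \<union> Y) \<subseteq> T"
      using flat_join[OF W(1) Y(1)] flat_join_le[OF W(1) Y(1) T] A' Y W by auto
    have AW: "A \<inter> cl M (W \<union> Y) = W" "r (cl M (W \<union> Y)) = r W + r Y"
      using perspectivity_Int[OF A T Y W(1) _ W(2)] AY W Y by (simp_all add: Int_commute rank_join)
    have "cl M (A \<union> Y) \<subseteq> cl M (A \<union> cl M (W \<union> Y))"
      using flat_join_upper[OF W(1) Y(1)] by (intro cl_mono) auto
    moreover have "cl M (A \<union> cl M (W \<union> Y)) \<subseteq> T"
      using flat_join_le[OF A'(1) J(1) T] A' J by simp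
    ultimately have "cl M (A \<union> cl M (W \<union> Y)) = T" using AY by simp
    from charpoly_perspectivity[OF A T J this] AW J show ?thesis by simp
  qed
  have "cl M (Z \<union> Y) \<subseteq> cl M (Z' \<union> Y)" using Z by (intro cl_mono) auto
  then have "(cl M (Z \<union> Y), cl M (Z' \<union> Y)) \<in> charpoly_step M T"
    using join[OF Z(1,5)] join[OF Z(2,4)] Z by (simp add: charpoly_step_def)
  then show ?case using step.IH by (meson rtrancl.rtrancl_into_rtrancl)
qed simp

end

text \<open>The line through two points of \<open>X\<close> has a third point in \<open>X\<close>;
  the rank bound expresses collinearity without naming the line. The empty set is thick.\<close>

definition thick :: "'a matroid_data \<Rightarrow> 'a set \<Rightarrow> bool" where
  "thick M X \<longleftrightarrow>
    (\<forall>x \<in> X. \<forall>y \<in> X. x \<noteq> y \<longrightarrow> (\<exists>z \<in> X. z \<noteq> x \<and> z \<noteq> y \<and> mrank M {x, y, z} \<le> 2))"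

text \<open>The invariant of the induction.\<close>

definition avoids_thick :: "'a matroid_data \<Rightarrow> 'a set \<Rightarrow> bool" where
  "avoids_thick M T \<longleftrightarrow>
    (\<forall>X. modular_in M X T \<longrightarrow> thick M X \<longrightarrow>
      (\<exists>Y. ({}, Y) \<in> (charpoly_step M T)\<^sup>* \<and> Y \<inter> X = {} \<and> mrank M Y + mrank M X = mrank M T))"

section \<open>Thick flats of simple matroids and modular joins\<close>

locale loopless_simple_matroid = matroid +
  assumes pair_indep: "x \<in> ground M \<Longrightarrow> y \<in> ground M \<Longrightarrow> {x, y} \<in> indep M"
begin

lemma rank_singleton: "x \<in> E \<Longrightarrow> r {x} = 1"
  using rank_indep[OF pair_indep[of x x]] by simp

lemma rank_pair: "x \<in> E \<Longrightarrow> y \<in> E \<Longrightarrow> x \<noteq> y \<Longrightarrow> r {x, y} = 2"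
  using rank_indep[OF pair_indep[of x y]] by simp

lemma empty_flat: "{} \<in> L"
  using rank_singleton by (auto simp: flats_def cl_def)

lemma singleton_flat: "x \<in> E \<Longrightarrow> {x} \<in> L"
proof -
  assume x: "x \<in> E"
  have "y = x" if "y \<in> cl M {x}" for y
    using that rank_singleton[OF x] rank_pair[of y x] x by (cases "y = x") (auto simp: mem_cl_iff)
  then show ?thesis using cl_superset[of "{x}"] x by (auto simp: flats_def)
qed

lemma collinear_mem_flat:
  assumes "F \<in> L" "x \<in> F" "y \<in> F" "x \<noteq> y" "r {x, y, z} \<le> 2" "z \<in> E"
  shows "z \<in> F"
proof -
  have "x \<in> E" "y \<in> E" using assms flat_subset by auto
  then have "z \<in> cl M {x, y}" using assms rank_pair by (intro mem_clI[of z "{x, y}" "{x, y, z}"]) auto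
  then show ?thesis using cl_least[OF assms(1), of "{x, y}"] assms(2,3) by auto
qed

lemma thick_Int:
  assumes "thick M X" "X \<subseteq> E" "F \<in> L"
  shows "thick M (X \<inter> F)"
  unfolding thick_def
proof (intro ballI impI)
  fix x y assume xy: "x \<in> X \<inter> F" "y \<in> X \<inter> F" "x \<noteq> y"
  then obtain z where z: "z \<in> X" "z \<noteq> x" "z \<noteq> y" "r {x, y, z} \<le> 2"
    using assms(1) unfolding thick_def by blast
  then have "z \<in> F" using collinear_mem_flat[OF assms(3), of x y z] xy assms(2) by auto
  then show "\<exists>z \<in> X \<inter> F. z \<noteq> x \<and> z \<noteq> y \<and> r {x, y, z} \<le> 2" using z by auto
qed

text \<open>Suppose \<open>x\<close> in \<open>X\<close> is outside \<open>A\<close> and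
  \<open>y\<close> in \<open>X\<close> outside \<open>B\<close>, so that \<open>x\<close> is in
  \<open>B\<close> and \<open>y\<close> in \<open>A\<close>. A third point of their line can be in
  neither flat: together with \<open>y\<close> it would force \<open>x\<close> into
  \<open>A\<close>, together with \<open>x\<close> it would force \<open>y\<close> into
  \<open>B\<close>.\<close>

lemma thick_subset_Un:
  assumes "thick M X" "A \<in> L" "B \<in> L" "X \<subseteq> A \<union> B"
  shows "X \<subseteq> A \<or> X \<subseteq> B"
proof (rule ccontr)
  assume "\<not> ?thesis"
  then obtain x y where xy: "x \<in> X" "x \<notin> A" "y \<in> X" "y \<notin> B" by auto
  then have B: "x \<in> B" "y \<in> A" "x \<noteq> y" using assms by auto
  then obtain z where z: "z \<in> X" "z \<noteq> x" "z \<noteq> y" "r {x, y, z} \<le> 2"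
    using assms(1) xy unfolding thick_def by blast
  have E: "x \<in> E" "y \<in> E" using B flat_subset assms by auto
  have "z \<notin> A"
    using collinear_mem_flat[OF assms(2), of y z x] z xy B E by (auto simp: insert_commute)
  moreover have "z \<notin> B"
    using collinear_mem_flat[OF assms(3), of x z y] z xy B E by (auto simp: insert_commute)
  ultimately show False using z assms by auto
qed

lemma line_exchange:
  assumes "p \<in> cl M {x, a}" "p \<noteq> a" "x \<in> E" "a \<in> E"
  shows "x \<in> cl M {p, a}"
proof -
  have p: "p \<in> E" using assms cl_subset_ground by auto
  have "r {x, a} \<le> 2" using rank_le_card[of "{x, a}"] by (cases "x = a") auto
  then have "r (cl M {x, a}) \<le> r {p, a}" using rank_cl[of "{x, a}"] rank_pair[of p a] p assms by auto
  then show ?thesis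
    using assms cl_superset[of "{x, a}"] by (intro mem_clI[of x "{p, a}" "cl M {x, a}"]) auto
qed

lemma modular_in_empty: "modular_in M {} T"
  using empty_flat by (simp add: modular_in_def)

text \<open>The end of the combined path is \<open>Z \<or> Y\<close>, where \<open>Y\<close> is a
  complement of \<open>A \<inter> B\<close> in \<open>A\<close> and \<open>Z\<close> one of
  \<open>X\<close> in \<open>B\<close>. It meets \<open>B\<close> exactly in \<open>Z\<close>, hence
  misses \<open>X\<close>, and its rank is \<open>r Z + r Y\<close>.\<close>

lemma avoids_thick_join_aux:
  assumes A: "modular_in M A T" and B: "modular_in M B T" and T: "T \<in> L" "T = A \<union> B"
    and thick: "thick M (A \<inter> B)" and GA: "avoids_thick M A" and GB: "avoids_thick M B"
    and X: "modular_in M X T" "thick M X" "X \<subseteq> B"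
  shows "\<exists>Y. ({}, Y) \<in> (charpoly_step M T)\<^sup>* \<and> Y \<inter> X = {} \<and> r Y + r X = r T"
proof -
  note A' = modular_in_flat[OF A] modular_in_subset[OF A]
  note B' = modular_in_flat[OF B] modular_in_subset[OF B]
  have "modular_in M (A \<inter> B) A" using modular_in_Int[OF B A'] by (simp add: Int_commute)
  then obtain Y where Y: "({}, Y) \<in> (charpoly_step M A)\<^sup>*" "Y \<inter> (A \<inter> B) = {}"
      "r Y + r (A \<inter> B) = r A"
    using GA thick unfolding avoids_thick_def by blast
  have YA: "Y \<in> L" "Y \<subseteq> A" using charpoly_path_flat[OF Y(1) empty_flat] by auto
  have YB: "Y \<inter> B = {}" using Y YA by auto
  have YT: "Y \<subseteq> T" using YA A' by auto
  have pathY: "({}, Y) \<in> (charpoly_step M T)\<^sup>*"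
    by (rule charpoly_path_join[OF A B T empty_flat Y(1) YB])
  have rT: "r Y + r B = r T" using modular_inD[OF A B'] Y T by simp
  have "modular_in M X B" using X B' by (intro modular_in_mono[OF X(1)]) auto
  then obtain Z where Z: "({}, Z) \<in> (charpoly_step M B)\<^sup>*" "Z \<inter> X = {}" "r Z + r X = r B"
    using GB X unfolding avoids_thick_def by blast
  have ZB: "Z \<in> L" "Z \<subseteq> B" using charpoly_path_flat[OF Z(1) empty_flat] by auto
  have BY: "B \<inter> Y = {}" using YB by auto
  have "cl M (B \<union> Y) = T"
  proof (rule flat_eqI)
    show "r T \<le> r (cl M (B \<union> Y))"
      using rT modular_inD[OF B YA(1) YT] BY B' YA by (simp add: rank_join)
  qed (use B' YA YT T flat_join flat_join_le in auto)
  from charpoly_path_perspectivity[OF B T(1) YA(1) YT BY this Z(1)]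
  have "(Y, cl M (Z \<union> Y)) \<in> (charpoly_step M T)\<^sup>*" using flat_cl[OF YA(1)] by simp
  with pathY have "({}, cl M (Z \<union> Y)) \<in> (charpoly_step M T)\<^sup>*" by (rule rtrancl_trans)
  moreover have "cl M (Z \<union> Y) \<inter> B = Z" "r (Z \<union> Y) = r Z + r Y"
    using perspectivity_Int[OF B T(1) YA(1) YT ZB(1) _ ZB(2)] BY by simp_all
  moreover from this have "cl M (Z \<union> Y) \<inter> X = {}" using X Z by auto
  ultimately show ?thesis using rT Z ZB YA by (intro exI[of _ "cl M (Z \<union> Y)"]) (simp add: rank_join)
qed

lemma avoids_thick_join:
  assumes A: "modular_in M A T" and B: "modular_in M B T" and T: "T \<in> L" "T = A \<union> B"
    and thick: "thick M (A \<inter> B)" and G: "avoids_thick M A" "avoids_thick M B"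
  shows "avoids_thick M T"
  unfolding avoids_thick_def
proof (intro allI impI)
  fix X assume X: "modular_in M X T" "thick M X"
  have T': "T = B \<union> A" and thick': "thick M (B \<inter> A)" using T thick by (auto simp: Int_commute)
  have "X \<subseteq> A \<or> X \<subseteq> B"
    using X A B T modular_in_subset[OF X(1)] by (intro thick_subset_Un) (auto dest: modular_in_flat)
  then show "\<exists>Y. ({}, Y) \<in> (charpoly_step M T)\<^sup>* \<and> Y \<inter> X = {} \<and> r Y + r X = r T"
    using avoids_thick_join_aux[OF A B T thick G X]
      avoids_thick_join_aux[OF B A T(1) T' thick' G(2,1) X] by blast
qed

section \<open>Extension by a modular coatom\<close>

context
  fixes H T :: "'a set" and a :: 'a
  assumes H: "modular_in M H T" and T: "T \<in> L" and rank_T: "r T = Suc (r H)"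
    and a: "a \<in> T" "a \<notin> H"
begin

lemma coatom_facts: "H \<in> L" "H \<subseteq> T" "a \<in> E" "{a} \<in> L" "{a} \<subseteq> T" "H \<inter> {a} = {}"
  using modular_in_flat[OF H] modular_in_subset[OF H] T a flat_subset singleton_flat by auto

lemma rank_insert_coatom: "F \<in> L \<Longrightarrow> F \<subseteq> H \<Longrightarrow> r (insert a F) = Suc (r F)"
  using rank_insert_flat[of F a] coatom_facts a by auto

lemma rank_Un_coatom:
  assumes "K \<subseteq> T" "a \<in> K"
  shows "r (H \<union> K) = r T"
proof -
  have "r (insert a H) \<le> r (H \<union> K)" "r (H \<union> K) \<le> r T"
    using assms coatom_facts by (auto intro!: rank_mono)
  then show ?thesis using rank_insert_coatom[of H] coatom_facts rank_T by simp
qed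

lemma coatom_join: "cl M (H \<union> {a}) = T"
  using coatom_facts rank_Un_coatom[of "{a}"] T a flat_join[of H "{a}"] flat_join_le[of H "{a}" T]
    rank_join[of H "{a}"] by (intro flat_eqI) auto

lemma rank_Int_coatom: "K \<in> L \<Longrightarrow> K \<subseteq> T \<Longrightarrow> a \<in> K \<Longrightarrow> r K = Suc (r (H \<inter> K))"
  using modular_inD[OF H, of K] rank_Un_coatom[of K] rank_T by simp

lemma line_meets_coatom:
  assumes "s \<in> T" "s \<noteq> a"
  obtains z where "z \<in> H" "z \<in> cl M {s, a}"
proof -
  have E: "{s, a} \<subseteq> E" using assms a T flat_subset by auto
  have "cl M {s, a} \<subseteq> T" using assms a by (intro cl_least T) auto
  then have "r (H \<inter> cl M {s, a}) = 1"
    using rank_Int_coatom[OF cl_flat[OF E]] cl_superset[OF E] rank_cl[OF E] rank_pair[of s a] E assms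
    by auto
  then have "H \<inter> cl M {s, a} \<noteq> {}" by (metis rank_empty zero_neq_one)
  then show thesis using that by auto
qed

context
  fixes X :: "'a set"
  assumes X: "modular_in M X T" and aX: "a \<notin> X"
begin

text \<open>\<open>X'\<close> is the projection of \<open>X\<close> from the point \<open>a\<close> into the coatom \<open>H\<close>. A path in \<open>H\<close> that
  avoids \<open>X'\<close>, lifted to the interval above \<open>a\<close>, avoids \<open>X\<close>.\<close>

abbreviation "XP \<equiv> cl M (X \<union> {a})"
abbreviation "X' \<equiv> XP \<inter> H"

lemma cone_facts: "X \<in> L" "X \<subseteq> T" "XP \<in> L" "X \<subseteq> XP" "a \<in> XP" "XP \<subseteq> T" "X' \<in> L"
    "r XP = Suc (r X)" "r X' = r X"
proof -
  show XL: "X \<in> L" and XT: "X \<subseteq> T" using modular_in_flat[OF X] modular_in_subset[OF X] by auto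
  show XP: "XP \<in> L" "X \<subseteq> XP" "a \<in> XP" "XP \<subseteq> T"
    using flat_join[OF XL coatom_facts(4)] flat_join_upper[OF XL coatom_facts(4)]
      flat_join_le[OF XL coatom_facts(4) T] XT a by auto
  then show "X' \<in> L" using flat_Int coatom_facts by auto
  show "r XP = Suc (r X)"
    using rank_join[OF XL coatom_facts(4)] rank_insert_flat[OF XL coatom_facts(3) aX] by simp
  then show "r X' = r X" using rank_Int_coatom[of XP] XP by (simp add: Int_commute)
qed

text \<open>Modularity of \<open>X'\<close> against \<open>F\<close> is modularity of
  \<open>X\<close> against the cone \<open>G\<close> over \<open>F\<close> with apex
  \<open>a\<close>. Going from (\<open>X'\<close>, \<open>F\<close>) to (\<open>X\<close>,
  \<open>G\<close>), the rank of the second flat and that of the union grow by one, the other two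
  ranks stay.\<close>

lemma modular_in_projection: "modular_in M X' H"
  unfolding modular_in_def
proof (intro conjI ballI impI)
  show "X' \<in> L" by (rule cone_facts)
  fix F assume F: "F \<in> L" "F \<subseteq> H"
  define G where "G = cl M (F \<union> {a})"
  have G: "G \<in> L" "F \<subseteq> G" "a \<in> G" "G \<subseteq> T"
    using flat_join[OF F(1) coatom_facts(4)] flat_join_upper[OF F(1) coatom_facts(4)]
      flat_join_le[OF F(1) coatom_facts(4) T] F coatom_facts a unfolding G_def by auto
  have rG: "r G = Suc (r F)"
    using rank_join[OF F(1) coatom_facts(4)] rank_insert_coatom[OF F] by (simp add: G_def)
  have GH: "G \<inter> H = F"
    using perspectivity_Int(1)[OF H T coatom_facts(4,5) F(1) _ F(2)] coatom_facts
    by (simp add: G_def)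
  define K where "K = XP \<inter> G"
  have K: "K \<in> L" "a \<in> K" "K \<subseteq> T" "K \<subseteq> XP" using G cone_facts flat_Int by (auto simp: K_def)
  \<comment> \<open>The intersection of the cones \<open>XP\<close> and \<open>G\<close> is itself
    the cone over \<open>X \<inter> G\<close>. Its trace on \<open>H\<close> is
    \<open>X' \<inter> F\<close>, and both bases have rank one less than the cone.\<close>
  have "cl M (K \<inter> X \<union> {a}) = K"
    using perspectivity_Un[OF X T coatom_facts(4,5) K(1)] K by simp
  moreover have "K \<inter> X = X \<inter> G" using cone_facts(4) by (auto simp: K_def)
  ultimately have "r K = r ((X \<inter> G) \<union> {a})"
    using rank_join[of "X \<inter> G" "{a}"] flat_Int[of X G] cone_facts G coatom_facts by simp
  then have "r K = Suc (r (X \<inter> G))"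
    using rank_insert_flat[of "X \<inter> G" a] flat_Int[of X G] cone_facts G coatom_facts aX by simp
  moreover have "H \<inter> K = X' \<inter> F" using GH by (auto simp: K_def)
  ultimately have rInt: "r (X' \<inter> F) = r (X \<inter> G)" using rank_Int_coatom[of K] K by simp
  \<comment> \<open>\<open>X\<close> and \<open>X'\<close> span the same cone with \<open>a\<close>,
    so \<open>X \<union> G\<close> and \<open>X' \<union> F \<union> {a}\<close> have the same
    closure.\<close>
  have "cl M (X' \<union> {a}) = XP"
    using perspectivity_Un[OF H T coatom_facts(4,5) cone_facts(3)] cone_facts coatom_join by simp
  moreover have sub: "X' \<union> F \<union> {a} \<subseteq> E" "X \<union> G \<subseteq> E"
    using cone_facts F G coatom_facts flat_subset by auto
  have "X \<union> G \<subseteq> cl M (X' \<union> {a}) \<union> cl M (F \<union> {a})"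
    using calculation cone_facts(4) by (auto simp: G_def)
  then have "X \<union> G \<subseteq> cl M (X' \<union> F \<union> {a})"
    using cl_mono[of "X' \<union> {a}" "X' \<union> F \<union> {a}"] cl_mono[of "F \<union> {a}" "X' \<union> F \<union> {a}"] by auto
  then have "r (X \<union> G) \<le> r (X' \<union> F \<union> {a})"
    using rank_mono rank_cl[OF sub(1)] by metis
  moreover have "X' \<union> F \<union> {a} \<subseteq> cl M (X \<union> G)"
    using cl_mono[of "X \<union> {a}" "X \<union> G"] cl_superset[OF sub(2)] G by auto
  then have "r (X' \<union> F \<union> {a}) \<le> r (X \<union> G)"
    using rank_mono rank_cl[OF sub(2)] by metis
  ultimately have "r (X \<union> G) = r (cl M (X' \<union> F) \<union> {a})"
    using rank_cl_Un[of "X' \<union> F" "{a}"] sub by simp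
  also have "\<dots> = Suc (r (X' \<union> F))"
    using rank_insert_coatom[of "cl M (X' \<union> F)"] flat_join[OF cone_facts(7) F(1)]
      flat_join_le[OF cone_facts(7) F(1) coatom_facts(1)] F rank_join[OF cone_facts(7) F(1)] by simp
  finally have "r (X \<union> G) = Suc (r (X' \<union> F))" .
  then show "r X' + r F = r (X' \<inter> F) + r (X' \<union> F)"
    using modular_inD[OF X G(1,4)] rInt rG cone_facts(9) by simp
qed auto

text \<open>The line through \<open>x\<close> and \<open>a\<close> has rank 2 inside
  \<open>XP\<close>, where the modular flat \<open>X\<close> has corank 1.\<close>

lemma line_meets_base:
  assumes x: "x \<in> X'"
  obtains p where "p \<in> X" "p \<in> cl M {x, a}"
proof -
  have xa: "x \<noteq> a" "x \<in> E" using x a coatom_facts flat_subset by auto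
  have E: "{x, a} \<subseteq> E" using xa coatom_facts by auto
  have le: "cl M {x, a} \<subseteq> XP" using x cone_facts by (intro cl_least) auto
  have "r (X \<union> cl M {x, a}) \<le> r XP" using le cone_facts by (intro rank_mono) auto
  moreover have "r X + r (cl M {x, a}) = r (X \<inter> cl M {x, a}) + r (X \<union> cl M {x, a})"
    using le cone_facts by (intro modular_inD[OF X cl_flat[OF E]]) auto
  moreover have "r (cl M {x, a}) = 2" using rank_cl[OF E] rank_pair[of x a] xa E by simp
  ultimately have "r (X \<inter> cl M {x, a}) \<noteq> 0" using cone_facts(8) by simp
  then have "X \<inter> cl M {x, a} \<noteq> {}" by auto
  then show thesis using that by auto
qed

text \<open>Two distinct points of \<open>F\<close> collinear with \<open>a\<close> would force
  \<open>a\<close> into \<open>F\<close>.\<close>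

lemma lines_meet_once:
  assumes F: "F \<in> L" "a \<notin> F" and xy: "x \<in> F" "y \<in> F" "x \<in> cl M {p, a}" "y \<in> cl M {p, a}"
    and p: "p \<in> E"
  shows "x = y"
proof (rule ccontr)
  assume "x \<noteq> y"
  have E: "x \<in> E" "y \<in> E" "{p, a} \<subseteq> E" using F xy p coatom_facts flat_subset by auto
  have "r {x, y, a} \<le> r (cl M {p, a})"
    using xy cl_superset[OF E(3)] by (intro rank_mono) auto
  also have "\<dots> \<le> card {p, a}" using rank_cl[OF E(3)] rank_le_card[of "{p, a}"] by simp
  also have "\<dots> \<le> 2" by (cases "p = a") auto
  finally show False
    using collinear_mem_flat[OF F(1) xy(1,2) \<open>x \<noteq> y\<close> _ coatom_facts(3)] F by simp
qed

text \<open>Lift \<open>x\<close> and \<open>y\<close> along lines through \<open>a\<close> to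
  \<open>p\<close> and \<open>q\<close> in \<open>X\<close>, take a third point \<open>s\<close> of
  their line, and project it back to \<open>z\<close>. All of this happens in the flat spanned by
  \<open>p\<close>, \<open>q\<close>, \<open>a\<close>, of rank at most 3, whose trace on
  \<open>H\<close> has rank at most 2.\<close>

lemma thick_projection:
  assumes "thick M X"
  shows "thick M X'"
  unfolding thick_def
proof (intro ballI impI)
  fix x y assume x: "x \<in> X'" and y: "y \<in> X'" and "x \<noteq> y"
  have XE: "X \<subseteq> E" "H \<subseteq> E" using cone_facts coatom_facts flat_subset by auto
  obtain p where p: "p \<in> X" "p \<in> cl M {x, a}" by (rule line_meets_base[OF x])
  obtain q where q: "q \<in> X" "q \<in> cl M {y, a}" by (rule line_meets_base[OF y])
  have xp: "x \<in> cl M {p, a}" using line_exchange[OF p(2)] p aX x XE coatom_facts by auto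
  have yq: "y \<in> cl M {q, a}" using line_exchange[OF q(2)] q aX y XE coatom_facts by auto
  have "p \<noteq> q"
    using lines_meet_once[OF coatom_facts(1) a(2), of x y p] x y xp yq \<open>x \<noteq> y\<close> p XE by auto
  then obtain s where s: "s \<in> X" "s \<noteq> p" "s \<noteq> q" "r {p, q, s} \<le> 2"
    using assms p q unfolding thick_def by blast
  have sE: "s \<in> E" "s \<in> T" "s \<noteq> a" using s XE aX cone_facts by auto
  obtain z where z: "z \<in> H" "z \<in> cl M {s, a}" by (rule line_meets_coatom[OF sE(2,3)])
  have sz: "s \<in> cl M {z, a}" using line_exchange[OF z(2)] z a sE coatom_facts by auto
  have "cl M {s, a} \<subseteq> XP" using s cone_facts by (intro cl_least) auto
  then have "z \<in> X'" using z by auto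
  \<comment> \<open>If \<open>z = x\<close>, then \<open>s\<close> and \<open>p\<close> are two
    points of \<open>X\<close> on one line through \<open>a\<close>. The lemma is used with the base
    \<open>X\<close> here, not with \<open>H\<close>.\<close>
  moreover have "z \<noteq> x"
    using lines_meet_once[OF cone_facts(1) aX, of s p x] s p sz x XE by auto
  moreover have "z \<noteq> y"
    using lines_meet_once[OF cone_facts(1) aX, of s q y] s q sz y XE by auto
  moreover have "r {x, y, z} \<le> 2"
  proof -
    define K where "K = cl M {p, q, a}"
    have E: "{p, q, a} \<subseteq> E" using p q XE coatom_facts by auto
    have KL: "K \<in> L" and pqa: "p \<in> K" "q \<in> K" "a \<in> K" and KT: "K \<subseteq> T"
      using cl_flat[OF E] cl_superset[OF E] cl_least[OF T, of "{p, q, a}"] p q a cone_facts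
      by (auto simp: K_def)
    have "s \<in> K" using collinear_mem_flat[OF KL pqa(1,2) \<open>p \<noteq> q\<close> s(4) sE(1)] .
    then have "cl M {p, a} \<subseteq> K" "cl M {q, a} \<subseteq> K" "cl M {s, a} \<subseteq> K"
      using pqa by (simp_all add: cl_least[OF KL])
    then have "{x, y, z} \<subseteq> H \<inter> K" using xp yq z x y by auto
    then have "r {x, y, z} \<le> r (H \<inter> K)" by (rule rank_mono)
    moreover have "r K \<le> 3"
      using rank_cl[OF E] rank_le_card[of "{p, q, a}"] card_insert_le_m1[of 3 "{q, a}" p]
        card_insert_le_m1[of 2 "{a}" q] by (simp add: K_def)
    ultimately show ?thesis using rank_Int_coatom[OF KL KT pqa(3)] by simp
  qed
  ultimately show "\<exists>z \<in> X'. z \<noteq> x \<and> z \<noteq> y \<and> r {x, y, z} \<le> 2" by blast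
qed

text \<open>The path starts with the point \<open>a\<close>, above which the interval looks like
  that below \<open>H\<close>. Its end \<open>W\<close> misses \<open>X\<close>: for
  \<open>p\<close> in both, the line through \<open>p\<close> and \<open>a\<close> would meet
  \<open>H\<close> in a point of \<open>W \<inter> H = Z\<close> that also lies in
  \<open>X'\<close>.\<close>

lemma avoiding_path_via_coatom:
  assumes G: "avoids_thick M H" and "thick M X"
  shows "\<exists>Y. ({}, Y) \<in> (charpoly_step M T)\<^sup>* \<and> Y \<inter> X = {} \<and> r Y + r X = r T"
proof -
  note Ha = coatom_facts
  obtain Z where Z: "({}, Z) \<in> (charpoly_step M H)\<^sup>*" "Z \<inter> X' = {}" "r Z + r X' = r H"
    using G modular_in_projection thick_projection[OF \<open>thick M X\<close>] unfolding avoids_thick_def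
    by blast
  have ZH: "Z \<in> L" "Z \<subseteq> H" using charpoly_path_flat[OF Z(1) empty_flat] by auto
  define W where "W = cl M (Z \<union> {a})"
  have "\<chi> {a} T = \<chi> {} H" using charpoly_perspectivity[OF H T Ha(4,5) coatom_join] Ha(6) by simp
  moreover have "\<chi> {} H dvd \<chi> {} T" using charpoly_modular_factor[OF H T empty_flat] by simp
  ultimately have "({}, {a}) \<in> charpoly_step M T"
    using Ha empty_flat rank_singleton by (simp add: charpoly_step_def)
  moreover have "({a}, W) \<in> (charpoly_step M T)\<^sup>*"
    using charpoly_path_perspectivity[OF H T Ha(4,5,6) coatom_join Z(1)] flat_cl[OF Ha(4)]
    by (simp add: W_def)
  ultimately have "({}, W) \<in> (charpoly_step M T)\<^sup>*" by (rule converse_rtrancl_into_rtrancl)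
  moreover have "r W = Suc (r Z)"
    using rank_join[OF ZH(1) Ha(4)] rank_insert_coatom[OF ZH] by (simp add: W_def)
  moreover have "W \<inter> X = {}"
  proof (rule ccontr)
    assume "W \<inter> X \<noteq> {}"
    then obtain p where p: "p \<in> W" "p \<in> X" by auto
    have W: "W \<in> L" "a \<in> W" "W \<inter> H = Z"
      using flat_join[OF ZH(1) Ha(4)] flat_join_upper[OF ZH(1) Ha(4)]
        perspectivity_Int(1)[OF H T Ha(4,5) ZH(1) _ ZH(2)] Ha(6) by (simp_all add: W_def)
    obtain z where z: "z \<in> H" "z \<in> cl M {p, a}"
      using line_meets_coatom[of p] p aX cone_facts by auto
    have "cl M {p, a} \<subseteq> W" "cl M {p, a} \<subseteq> XP"
      using cl_least[OF W(1), of "{p, a}"] cl_least[OF cone_facts(3), of "{p, a}"]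
        p W(2) cone_facts(4,5) by auto
    then show False using z W Z by auto
  qed
  ultimately show ?thesis using Z cone_facts(9) rank_T by (intro exI[of _ W]) simp
qed

end

end

text \<open>Projection needs a centre outside \<open>H \<union> X\<close>. If there is none,
  \<open>T\<close> is the union of the modular flats \<open>H\<close> and \<open>X\<close>, and a
  path in \<open>H\<close> to a complement of \<open>X \<inter> H\<close> is already a path in
  \<open>T\<close>, as in a modular join.\<close>

lemma avoids_thick_coatom:
  assumes H: "modular_in M H T" and T: "T \<in> L" and rank_T: "r T = Suc (r H)"
    and G: "avoids_thick M H"
  shows "avoids_thick M T"
  unfolding avoids_thick_def
proof (intro allI impI)
  fix X assume X: "modular_in M X T" "thick M X"
  note H' = modular_in_flat[OF H] modular_in_subset[OF H]
  note X' = modular_in_flat[OF X(1)] modular_in_subset[OF X(1)]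
  show "\<exists>Y. ({}, Y) \<in> (charpoly_step M T)\<^sup>* \<and> Y \<inter> X = {} \<and> r Y + r X = r T"
  proof (cases "T \<subseteq> H \<union> X")
    case False
    then obtain a where "a \<in> T" "a \<notin> H" "a \<notin> X" by auto
    then show ?thesis using avoiding_path_via_coatom[OF H T rank_T _ _ X(1) _ G X(2)] by simp
  next
    case True
    then have TU: "T = H \<union> X" using H' X' by auto
    obtain Y where Y: "({}, Y) \<in> (charpoly_step M H)\<^sup>*" "Y \<inter> (X \<inter> H) = {}"
        "r Y + r (X \<inter> H) = r H"
      using G modular_in_Int[OF X(1) H'] thick_Int[OF X(2) flat_subset[OF X'(1)] H'(1)]
      unfolding avoids_thick_def by blast
    have "Y \<subseteq> H" using charpoly_path_flat[OF Y(1) empty_flat] by auto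
    then have YX: "Y \<inter> X = {}" using Y by auto
    moreover have "({}, Y) \<in> (charpoly_step M T)\<^sup>*"
      by (rule charpoly_path_join[OF H X(1) T TU empty_flat Y(1) YX])
    moreover have "r Y + r X = r T"
      using modular_inD[OF H X'] Y TU by (simp add: Int_commute)
    ultimately show ?thesis by blast
  qed
qed

text \<open>Climb the chain by modular coatoms. Maximality of the chain is used as follows: a flat
  comparable with all its members belongs to it.\<close>

lemma avoids_thick_supersolvable:
  assumes "supersolvable M"
  shows "avoids_thick M E"
proof -
  obtain C where C: "subset.maxchain L C" and mod: "\<And>F. F \<in> C \<Longrightarrow> modular_in M F E"
    using assms modular_flat_imp_modular_in unfolding supersolvable_def by blast
  have total: "F \<subseteq> G \<or> G \<subseteq> F" if "F \<in> C" "G \<in> C" for F G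
    using C that by (auto simp: subset.maxchain_def subset_chain_def)
  have CL: "C \<subseteq> L" using C by (auto simp: subset.maxchain_def subset_chain_def)
  have maximal: "F \<in> C" if F: "F \<in> L" "\<And>G. G \<in> C \<Longrightarrow> F \<subseteq> G \<or> G \<subseteq> F" for F
  proof (rule ccontr)
    assume "F \<notin> C"
    have "subset.chain L (insert F C)"
      using F CL total by (auto simp: subset_chain_def)
    then show False using C \<open>F \<notin> C\<close> by (auto simp: subset.maxchain_def)
  qed
  have bot: "{} \<in> C" using maximal[OF empty_flat] by simp
  have "E \<in> C" using maximal[OF ground_flat] CL flat_subset by blast
  have "avoids_thick M T" if "finite T" "T \<in> C" for T
    using that
  proof (induction T rule: finite_psubset_induct)
    case (psubset T)
    have T: "T \<in> L" using psubset.prems CL by auto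
    show ?case
    proof (cases "T = {}")
      case True
      then show ?thesis
        unfolding avoids_thick_def by (auto dest: modular_in_subset intro!: exI[of _ "{}"])
    next
      case False
      let ?D = "{F \<in> C. F \<subset> T}"
      have "finite ?D" by (rule finite_subset[OF _ finite_flats]) (use CL in auto)
      moreover have "?D \<noteq> {}" using bot False by auto
      ultimately have "\<exists>H \<in> ?D. \<forall>F \<in> ?D. H \<subseteq> F \<longrightarrow> H = F" by (rule finite_has_maximal)
      then obtain H where HD: "H \<in> ?D" and max: "\<forall>F \<in> ?D. H \<subseteq> F \<longrightarrow> H = F" by (rule bexE)
      have H: "H \<in> C" "H \<subset> T" using HD by auto
      have H_max: "H = F" if "F \<in> C" "F \<subset> T" "H \<subseteq> F" for F using max that by simp
      have le_H: "F \<subseteq> H" if "F \<in> C" "F \<subset> T" for F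
        using total[OF that(1) H(1)] H_max[OF that] by auto
      obtain a where a: "a \<in> T" "a \<notin> H" using H by auto
      have aE: "a \<in> E" and HL: "H \<in> L" using a T flat_subset H CL by auto
      define K where "K = cl M (H \<union> {a})"
      have K: "K \<in> L" "H \<subseteq> K" "a \<in> K" "K \<subseteq> T"
        using flat_join[OF HL singleton_flat[OF aE]] flat_join_upper[OF HL singleton_flat[OF aE]]
          flat_join_le[OF HL singleton_flat[OF aE] T] H a by (auto simp: K_def)
      \<comment> \<open>Members of the chain either lie below \<open>H\<close> or contain
        \<open>T\<close>, so \<open>K\<close>, which lies between, is comparable with all of them.
        Hence \<open>K = T\<close>, and the rank rises by exactly one from \<open>H\<close> to
        \<open>T\<close>.\<close>
      have "K \<in> C"
      proof (rule maximal[OF K(1)])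
        fix F assume "F \<in> C"
        then show "K \<subseteq> F \<or> F \<subseteq> K"
          using total[OF \<open>F \<in> C\<close> psubset.prems] le_H[of F] K by auto
      qed
      then have "K = T" using le_H[of K] K a by auto
      then have "r T = Suc (r H)"
        using rank_join[OF HL singleton_flat[OF aE]] rank_insert_flat[OF HL aE a(2)]
        by (simp add: K_def)
      moreover have "modular_in M H T"
        using H flat_subset[OF T] by (intro modular_in_mono[OF mod]) auto
      ultimately show ?thesis
        using avoids_thick_coatom[OF _ T] psubset.IH[OF H(2,1)] by blast
    qed
  qed
  then show ?thesis using \<open>E \<in> C\<close> finite_ground by blast
qed

end

section \<open>Restrictions and contractions\<close>

context matroid
begin

lemma ground_restriction [simp]: "ground (restriction M S) = S"
  and ground_contraction [simp]: "ground (contraction M S) = E - S"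
  by (simp_all add: restriction_def contraction_def)

lemma mrank_restriction: "X \<subseteq> S \<Longrightarrow> mrank (restriction M S) X = r X"
  unfolding mrank_def restriction_def
  by (intro arg_cong[where f = "\<lambda>A. Max (card ` A)"]) auto

context
  fixes S :: "'a set"
  assumes S: "S \<in> L"
begin

abbreviation "N \<equiv> restriction M S"

lemma cl_restriction: "X \<subseteq> S \<Longrightarrow> cl N X = cl M X"
  using cl_least[OF S, of X] flat_subset[OF S]
  by (auto simp: cl_def mrank_restriction)

lemma flats_restriction: "flats N = {F \<in> L. F \<subseteq> S}"
  using flat_subset[OF S] by (auto simp: flats_def cl_restriction)

lemma flat_interval_restriction: "T \<subseteq> S \<Longrightarrow> flat_interval N Y T = flat_interval M Y T"
  by (auto simp: flat_interval_def flats_restriction)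

lemma interval_moebius_restriction: "F \<subseteq> S \<Longrightarrow> interval_moebius N Y F = \<mu> Y F"
proof -
  assume FS: "F \<subseteq> S"
  then have "finite F" using S finite_flat finite_subset by blast
  then show ?thesis using FS
  proof (induction F rule: finite_psubset_induct)
    case (psubset F)
    have "(\<Sum>Z \<in> {Z \<in> flats N. finite F \<and> Y \<subseteq> Z \<and> Z \<subset> F}. interval_moebius N Y Z)
        = (\<Sum>Z \<in> {Z \<in> L. finite F \<and> Y \<subseteq> Z \<and> Z \<subset> F}. \<mu> Y Z)"
    proof (rule sum.cong)
      show "{Z \<in> flats N. finite F \<and> Y \<subseteq> Z \<and> Z \<subset> F} = {Z \<in> L. finite F \<and> Y \<subseteq> Z \<and> Z \<subset> F}"
        using psubset.prems by (auto simp: flats_restriction)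
      show "interval_moebius N Y Z = \<mu> Y Z" if "Z \<in> {Z \<in> L. finite F \<and> Y \<subseteq> Z \<and> Z \<subset> F}" for Z
        using psubset.IH[of Z] that psubset.prems by auto
    qed
    then show ?case
      by (subst interval_moebius.simps, subst interval_moebius.simps[of M]) simp
  qed
qed

lemma interval_charpoly_restriction: "T \<subseteq> S \<Longrightarrow> interval_charpoly N Y T = \<chi> Y T"
  unfolding interval_charpoly_def
  by (intro sum.cong)
    (auto simp: flat_interval_restriction interval_moebius_restriction mrank_restriction)

text \<open>In a join the induction hypotheses concern the restrictions to the two sides, while the
  join argument takes place inside \<open>M\<close>.\<close>

lemma avoids_thick_restriction: "avoids_thick N S \<longleftrightarrow> avoids_thick M S"
proof -
  have step: "charpoly_step N S = charpoly_step M S"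
    unfolding charpoly_step_def flats_restriction
    by (auto simp: interval_charpoly_restriction mrank_restriction)
  have modular: "modular_in N X S \<longleftrightarrow> modular_in M X S" for X
    unfolding modular_in_def flats_restriction
    by (auto simp: mrank_restriction le_infI1)
  have thick: "thick N X \<longleftrightarrow> thick M X" if "X \<subseteq> S" for X
  proof -
    have "mrank N {x, y, z} = r {x, y, z}" if "x \<in> X" "y \<in> X" "z \<in> X" for x y z
      using that \<open>X \<subseteq> S\<close> by (intro mrank_restriction) auto
    then show ?thesis unfolding thick_def by (auto cong: ball_cong bex_cong)
  qed
  have rank: "mrank N Y + mrank N X = mrank N S \<longleftrightarrow> r Y + r X = r S"
    if "X \<subseteq> S" "({}, Y) \<in> (charpoly_step M S)\<^sup>*" for X Y
  proof -
    have "Y \<subseteq> S" using that(2) by (induction rule: rtrancl_induct) (auto simp: charpoly_step_def)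
    then show ?thesis using that by (simp add: mrank_restriction)
  qed
  show ?thesis
    unfolding avoids_thick_def step modular
    by (intro all_cong1 imp_cong ex_cong1 conj_cong refl thick rank)
      (assumption | erule modular_in_subset)+
qed

end

text \<open>The bound is attained by extending a basis of \<open>Y\<close> to a basis of
  \<open>Z \<union> Y\<close> and removing the elements of \<open>Y\<close>.\<close>

lemma mrank_contraction:
  assumes Y: "Y \<subseteq> E" and Z: "Z \<subseteq> E - Y"
  shows "mrank (contraction M Y) Z = r (Z \<union> Y) - r Y"
proof -
  let ?I = "{I. I \<subseteq> Z \<and> r (I \<union> Y) = card I + r Y}"
  have "mrank (contraction M Y) Z = Max (card ` ?I)"
    unfolding mrank_def[of "contraction M Y"] using Z
    by (intro arg_cong[where f = "\<lambda>A. Max (card ` A)"]) (auto simp: contraction_def)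
  also have "\<dots> = r (Z \<union> Y) - r Y"
  proof (rule Max_eqI)
    have "finite Z" using Z finite_ground finite_subset by blast
    then have "finite (Pow Z)" by simp
    then show "finite (card ` ?I)" by (rule finite_surj) auto
    show "k \<le> r (Z \<union> Y) - r Y" if k: "k \<in> card ` ?I" for k
    proof -
      obtain I where I: "k = card I" "I \<subseteq> Z" "r (I \<union> Y) = card I + r Y" using k by auto
      then have "r (I \<union> Y) \<le> r (Z \<union> Y)" by (intro rank_mono) auto
      then show ?thesis using I by simp
    qed
    obtain B where B: "B \<in> indep M" "B \<subseteq> Y" "card B = r Y" by (rule basis_exists)
    obtain K where K: "K \<in> indep M" "B \<subseteq> K" "K \<subseteq> Z \<union> Y" "card K = r (Z \<union> Y)"
      using extend_basis[of B "Z \<union> Y"] B by auto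
    have fin: "finite K" using K finite_indep by auto
    have "K \<inter> Y \<in> indep M" using K(1) by (rule indep_mono) auto
    then have "card (K \<inter> Y) \<le> r Y" using card_le_rank by auto
    moreover have "card B \<le> card (K \<inter> Y)" using B K fin by (intro card_mono) auto
    ultimately have "card (K - Y) = r (Z \<union> Y) - r Y"
      using card_Diff_subset_Int[of K Y] fin K B by simp
    moreover have "r (K - Y \<union> Y) = r (Z \<union> Y)"
    proof (rule antisym)
      show "r (K - Y \<union> Y) \<le> r (Z \<union> Y)" using K by (intro rank_mono) auto
      have "r K \<le> r (K - Y \<union> Y)" by (intro rank_mono) auto
      then show "r (Z \<union> Y) \<le> r (K - Y \<union> Y)" using K rank_indep[of K] by simp
    qed
    moreover have "r Y \<le> r (Z \<union> Y)" by (rule rank_mono) auto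
    ultimately show "r (Z \<union> Y) - r Y \<in> card ` ?I"
      using K by (intro image_eqI[of _ _ "K - Y"]) auto
  qed
  finally show ?thesis .
qed

context
  fixes Y :: "'a set"
  assumes Y: "Y \<in> L"
begin

abbreviation "C \<equiv> contraction M Y"

lemma cl_contraction: "X \<subseteq> E - Y \<Longrightarrow> cl C X = cl M (X \<union> Y) - Y"
proof -
  assume X: "X \<subseteq> E - Y"
  have YE: "Y \<subseteq> E" using Y flat_subset by auto
  have "x \<in> cl C X \<longleftrightarrow> x \<in> cl M (X \<union> Y)" if x: "x \<in> E - Y" for x
  proof -
    have "r Y \<le> r (X \<union> Y)" "r Y \<le> r (insert x (X \<union> Y))" by (intro rank_mono, auto)+
    then show ?thesis
      using mrank_contraction[OF YE X] mrank_contraction[OF YE, of "insert x X"] x X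
      by (auto simp: cl_def)
  qed
  moreover have "cl C X \<subseteq> E - Y" by (auto simp: cl_def)
  ultimately show ?thesis using cl_subset_ground by blast
qed

lemma flats_contraction: "flats C = (\<lambda>F. F - Y) ` {F \<in> L. Y \<subseteq> F}"
proof (intro equalityI subsetI)
  have YE: "Y \<subseteq> E" using Y flat_subset by auto
  fix X assume "X \<in> flats C"
  then have X: "X \<subseteq> E - Y" "cl C X = X" by (auto simp: flats_def)
  then have "cl M (X \<union> Y) - Y = X" using cl_contraction by simp
  moreover have "X \<union> Y \<subseteq> E" using X YE by auto
  moreover from this have "Y \<subseteq> cl M (X \<union> Y)" using cl_superset[of "X \<union> Y"] by auto
  ultimately show "X \<in> (\<lambda>F. F - Y) ` {F \<in> L. Y \<subseteq> F}"
    by (intro image_eqI[of _ _ "cl M (X \<union> Y)"]) (simp_all add: cl_flat)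
next
  fix X assume "X \<in> (\<lambda>F. F - Y) ` {F \<in> L. Y \<subseteq> F}"
  then obtain F where F: "F \<in> L" "Y \<subseteq> F" "X = F - Y" by auto
  then have X: "X \<subseteq> E - Y" "X \<union> Y = F" using flat_subset by auto
  then show "X \<in> flats C"
    using cl_contraction[OF X(1)] flat_cl[OF F(1)] F(3)
    by (simp add: flats_def)
qed

lemma moebius_contraction: "F \<in> L \<Longrightarrow> Y \<subseteq> F \<Longrightarrow> moebius C (F - Y) = \<mu> Y F"
proof -
  assume F: "F \<in> L" "Y \<subseteq> F"
  have "finite F" using F finite_flat by auto
  then show ?thesis using F
  proof (induction F rule: finite_psubset_induct)
    case (psubset F)
    \<comment> \<open>The recursion for \<open>moebius\<close> starts at the closure of the empty
      set. As \<open>Y\<close> is a flat, the contraction has no loops and this bottom corresponds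
      to \<open>Y\<close>.\<close>
    have bot: "cl C {} = {}" using cl_contraction[of "{}"] flat_cl[OF Y] by simp
    let ?S = "{Z \<in> L. finite F \<and> Y \<subseteq> Z \<and> Z \<subset> F}"
    have S: "{X \<in> flats C. finite (F - Y) \<and> X \<subset> F - Y} = (\<lambda>Z. Z - Y) ` ?S"
    proof -
      have "finite (F - Y) \<and> Z - Y \<subset> F - Y \<longleftrightarrow> finite F \<and> Z \<subset> F" if "Y \<subseteq> Z" for Z
        using that psubset.prems psubset.hyps by auto
      then show ?thesis unfolding flats_contraction by blast
    qed
    have inj: "inj_on (\<lambda>Z. Z - Y) ?S"
      by (rule inj_on_inverseI[where g = "\<lambda>Z. Z \<union> Y"]) (simp add: Un_absorb2)
    have "(\<Sum>X \<in> {X \<in> flats C. finite (F - Y) \<and> X \<subset> F - Y}. moebius C X)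
        = (\<Sum>Z \<in> ?S. moebius C (Z - Y))"
      unfolding S using sum.reindex[OF inj] by simp
    also have "\<dots> = (\<Sum>Z \<in> ?S. \<mu> Y Z)" using psubset.IH by (intro sum.cong) auto
    finally have "(\<Sum>X \<in> {X \<in> flats C. finite (F - Y) \<and> X \<subset> F - Y}. moebius C X)
        = (\<Sum>Z \<in> ?S. \<mu> Y Z)" .
    moreover have "F - Y = cl C {} \<longleftrightarrow> F = Y" using psubset.prems bot by auto
    ultimately show ?case
      by (subst moebius.simps, subst interval_moebius.simps) simp
  qed
qed

lemma charpoly_contraction: "charpoly C = \<chi> Y E"
proof -
  have YE: "Y \<subseteq> E" using Y flat_subset by auto
  have rank: "mrank C (F - Y) = r F - r Y" if "Y \<subseteq> F" "F \<subseteq> E" for F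
  proof -
    have eq: "F - Y \<union> Y = F" and "F - Y \<subseteq> E - Y" using that by auto
    from mrank_contraction[OF YE this(2)] show ?thesis by (simp only: eq)
  qed
  have "inj_on (\<lambda>F. F - Y) (flat_interval M Y E)"
    by (rule inj_on_inverseI[where g = "\<lambda>F. F \<union> Y"]) (simp add: Un_absorb2)
  moreover have "flats C = (\<lambda>F. F - Y) ` flat_interval M Y E"
    unfolding flats_contraction using flat_subset
    by (intro arg_cong[where f = "image _"]) (auto simp: flat_interval_def)
  ultimately have "charpoly C = (\<Sum>F \<in> flat_interval M Y E.
      monom (moebius C (F - Y)) (mrank C (E - Y) - mrank C (F - Y)))"
    by (simp add: charpoly_def sum.reindex)
  also have "\<dots> = \<chi> Y E"
    unfolding interval_charpoly_def
  proof (intro sum.cong refl)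
    fix F assume "F \<in> flat_interval M Y E"
    then have F: "F \<in> L" "Y \<subseteq> F" "F \<subseteq> E" by auto
    have "r Y \<le> r F" using F by (intro rank_mono)
    then have "mrank C (E - Y) - mrank C (F - Y) = r E - r F"
      using rank[OF YE order_refl] rank[OF F(2,3)] by simp
    then show "monom (moebius C (F - Y)) (mrank C (E - Y) - mrank C (F - Y))
        = monom (\<mu> Y F) (r E - r F)"
      using moebius_contraction[OF F(1,2)] by simp
  qed
  finally show ?thesis .
qed

end

end

section \<open>Divisional flags for the class\<close>

text \<open>For lines spanned by \<open>u\<close> and \<open>v\<close> the third one is spanned by
  \<open>u + v\<close>, a choice that works over every field, even the one with two elements. The
  three lines lie in the span of \<open>u\<close> and \<open>v\<close>, so their sum has dimension
  at most 2.\<close>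

lemma projective_line_third_point:
  fixes L1 L2 :: "(nat \<Rightarrow> 'f::field) set" and F :: "'f itself"
  assumes "L1 \<in> ground (proj_geom F d)" "L2 \<in> ground (proj_geom F d)" "L1 \<noteq> L2"
  obtains L3 where "L3 \<in> ground (proj_geom F d)" "L3 \<noteq> L1" "L3 \<noteq> L2"
    "{L1, L2, L3} \<notin> indep (proj_geom F d)"
proof -
  have ground: "ground (proj_geom F d) = {L. seq.subspace L \<and> seq.dim L = 1 \<and> L \<subseteq> coord_space d}"
    by (simp add: proj_geom_def Let_def)
  have dim_indep: "seq.dim (seq.span (\<Union>S)) = card S" if "S \<in> indep (proj_geom F d)" for S
    using that by (simp add: proj_geom_def Let_def)
  have line: "\<exists>u. u \<noteq> 0 \<and> u \<in> coord_space d \<and> K = seq.span {u}"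
    if "K \<in> ground (proj_geom F d)" for K
  proof -
    have K: "seq.subspace K" "seq.dim K = 1" "K \<subseteq> coord_space d" using that by (auto simp: ground)
    obtain B where B: "B \<subseteq> K" "seq.independent B" "K \<subseteq> seq.span B" "card B = seq.dim K"
      by (rule seq.basis_exists)
    then obtain u where u: "B = {u}" using K by (auto simp: card_1_singleton_iff)
    then have "K = seq.span {u}" using B K seq.span_minimal by blast
    moreover have "u \<noteq> 0" using B u seq.dependent_zero by auto
    ultimately show ?thesis using B u K by auto
  qed
  obtain u where u: "u \<noteq> 0" "u \<in> coord_space d" "L1 = seq.span {u}" using line assms by blast
  obtain v where v: "v \<noteq> 0" "v \<in> coord_space d" "L2 = seq.span {v}" using line assms by blast
  have span_sub: "seq.span {x} \<subseteq> K" if "x \<in> K" "seq.subspace K" for x and K :: "(nat \<Rightarrow> 'f) set"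
    using that by (intro seq.span_minimal) auto
  have sub: "seq.subspace (coord_space d)"
    by (auto simp: seq.subspace_def coord_space_def seq_scale_def)
  define w where "w = u + v"
  define L3 where "L3 = seq.span {w}"
  have in_span: "x \<in> seq.span {x}" for x :: "nat \<Rightarrow> 'f" by (simp add: seq.span_base)
  have not_sub: "\<not> L2 \<subseteq> L1" and not_sub': "\<not> L1 \<subseteq> L2"
  proof -
    have "L1 = L2" if "x \<noteq> 0" "x \<in> L1" "x \<in> L2" for x
    proof -
      have "y \<in> seq.span {x}" if y: "x \<in> seq.span {y}" for y
      proof -
        obtain k where k: "x = seq_scale k y" using y by (auto simp: seq.span_singleton)
        then have "k \<noteq> 0" using \<open>x \<noteq> 0\<close> by auto
        then have "y = seq_scale (inverse k) x" using k by simp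
        then show ?thesis by (metis in_span seq.span_scale)
      qed
      then have eq: "seq.span {y} = seq.span {x}" if "x \<in> seq.span {y}" for y
        using that span_sub[of x "seq.span {y}"] span_sub[of y "seq.span {x}"] by auto
      show ?thesis using eq[of u] eq[of v] that u v by simp
    qed
    then show "\<not> L2 \<subseteq> L1" "\<not> L1 \<subseteq> L2" using u v in_span[of u] in_span[of v] assms(3) by auto
  qed
  have L12: "seq.subspace L1" "seq.subspace L2" "u \<in> L1" "v \<in> L2" using u v in_span by auto
  have wL3: "w \<in> L3" using in_span by (simp add: L3_def)
  have not: "v \<notin> L1" "u \<notin> L2"
    using not_sub not_sub' L12 span_sub[of v L1] span_sub[of u L2] u v by auto
  have w: "w \<notin> L1" "w \<notin> L2"
    using seq.subspace_diff[of L1 w u] seq.subspace_diff[of L2 w v] L12 not by (auto simp: w_def)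
  have ne: "L3 \<noteq> L1" "L3 \<noteq> L2" using w wL3 by auto
  have "w \<noteq> 0" using w seq.subspace_0[OF L12(1)] by auto
  then have "seq.independent {w}" by simp
  then have "seq.dim L3 = 1"
    by (simp add: L3_def seq.dim_eq_card_independent del: seq.dependent_single)
  then have "L3 \<in> ground (proj_geom F d)"
    using u v sub span_sub[of w "coord_space d"] seq.subspace_add[OF sub, of u v]
    by (simp add: ground L3_def w_def)
  moreover have "{L1, L2, L3} \<notin> indep (proj_geom F d)"
  proof
    assume "{L1, L2, L3} \<in> indep (proj_geom F d)"
    from dim_indep[OF this] have dim: "seq.dim (\<Union>{L1, L2, L3}) = 3"
      using ne assms(3) by (simp only: seq.dim_span) simp
    have uv: "u \<in> seq.span {u, v}" "v \<in> seq.span {u, v}" by (simp_all add: seq.span_base)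
    then have "w \<in> seq.span {u, v}" unfolding w_def by (rule seq.span_add)
    then have "\<Union>{L1, L2, L3} \<subseteq> seq.span {u, v}"
      using span_sub[of _ "seq.span {u, v}"] uv by (simp add: u v L3_def)
    then have "seq.dim (\<Union>{L1, L2, L3}) \<le> card {u, v}" by (intro seq.dim_le_card) auto
    moreover have "card {u, v} \<le> 2" by (cases "u = v") auto
    ultimately show False using dim by simp
  qed
  ultimately show thesis using that ne by blast
qed

lemma (in matroid) thick_if_projective:
  assumes iso: "matroid_iso (restriction M X) (proj_geom F d)"
  shows "thick M X"
  unfolding thick_def
proof (intro ballI impI)
  obtain f where f: "bij_betw f X (ground (proj_geom F d))"
      and f_indep: "\<And>I. I \<subseteq> X \<Longrightarrow> I \<in> indep M \<longleftrightarrow> f ` I \<in> indep (proj_geom F d)"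
    using iso unfolding matroid_iso_def by (auto simp: restriction_def)
  fix x y assume xy: "x \<in> X" "y \<in> X" "x \<noteq> y"
  have "f x \<in> ground (proj_geom F d)" "f y \<in> ground (proj_geom F d)" "f x \<noteq> f y"
    using f xy by (auto simp: bij_betw_def inj_on_def)
  then obtain l where l: "l \<in> ground (proj_geom F d)" "l \<noteq> f x" "l \<noteq> f y"
      "{f x, f y, l} \<notin> indep (proj_geom F d)"
    by (rule projective_line_third_point)
  then obtain z where z: "z \<in> X" "l = f z" using f by (auto simp: bij_betw_def)
  then have ne: "z \<noteq> x" "z \<noteq> y" using l by auto
  have "{x, y, z} \<notin> indep M" using f_indep[of "{x, y, z}"] xy z l by simp
  then have "r {x, y, z} \<noteq> card {x, y, z}" by (simp add: indep_iff_rank)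
  then have "r {x, y, z} \<le> 2" using rank_le_card[of "{x, y, z}"] ne xy by auto
  then show "\<exists>z \<in> X. z \<noteq> x \<and> z \<noteq> y \<and> r {x, y, z} \<le> 2" using z ne by blast
qed

lemma loopless_simple_matroid_iff: "loopless_simple_matroid M \<longleftrightarrow> simple_matroid M"
  by (auto simp: simple_matroid_def loopless_simple_matroid_def loopless_simple_matroid_axioms_def)

lemma pg_join_class_avoids_thick:
  "pg_join_class F M \<Longrightarrow> avoids_thick M (ground M)"
proof (induction rule: pg_join_class.induct)
  case (supersolvable M)
  interpret loopless_simple_matroid M
    using supersolvable by (simp add: loopless_simple_matroid_iff)
  show ?case using supersolvable by (simp add: avoids_thick_supersolvable)
next
  case (join M X M1 M2 d)
  interpret loopless_simple_matroid M
    using join by (simp add: loopless_simple_matroid_iff)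
  obtain E1 E2 where E: "modular_flat M E1" "modular_flat M E2" "E = E1 \<union> E2" "X = E1 \<inter> E2"
      and M: "M1 = restriction M E1" "M2 = restriction M E2"
    using join.hyps by (auto simp: modular_join_def)
  have mod: "modular_in M E1 E" "modular_in M E2 E"
    using E modular_flat_imp_modular_in by auto
  have "avoids_thick M1 E1" "avoids_thick M2 E2"
    using join.IH by (simp_all add: M)
  then have "avoids_thick M E1" "avoids_thick M E2"
    using avoids_thick_restriction modular_in_flat[OF mod(1)] modular_in_flat[OF mod(2)]
    by (simp_all add: M)
  moreover have "thick M (E1 \<inter> E2)"
    using thick_if_projective join.hyps E(4) by blast
  ultimately show ?case using avoids_thick_join[OF mod ground_flat E(3)] by simp
qed

text \<open>The invariant for \<open>X = {}\<close> yields a path whose end has full rank, hence is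
  the ground set. Each step raises the rank by one, so the length of the path is the rank of
  \<open>M\<close>.\<close>

lemma (in loopless_simple_matroid) divisional_flag_exists:
  assumes "avoids_thick M E"
  shows "\<exists>X. divisional_flag M X"
proof -
  have "thick M {}" by (simp add: thick_def)
  then obtain Y where Y: "({}, Y) \<in> (charpoly_step M E)\<^sup>*" "r Y = r E"
    using assms modular_in_empty unfolding avoids_thick_def by fastforce
  have "Y \<in> L" "Y \<subseteq> E" using charpoly_path_flat[OF Y(1) empty_flat] by auto
  then have "Y = E" using flat_eqI[of Y E] ground_flat Y by simp
  with Y obtain n X where X: "X 0 = {}" "X n = E"
      and step: "\<And>i. i < n \<Longrightarrow> (X i, X (Suc i)) \<in> charpoly_step M E"
    by (auto simp: rtrancl_power relpow_fun_conv)
  have flat: "X i \<in> L \<and> r (X i) = i" if "i \<le> n" for i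
    using that
  proof (induction i)
    case (Suc i)
    then show ?case using step[of i] by (auto simp: charpoly_step_def)
  qed (simp add: X empty_flat)
  from this[of n] have n: "r E = n" using X by simp
  have "X i \<subseteq> X (Suc i) \<and>
      charpoly (contraction M (X (Suc i))) dvd charpoly (contraction M (X i))" if "i < n" for i
    using step[OF that] by (auto simp: charpoly_step_def charpoly_contraction)
  then have "divisional_flag M X"
    unfolding divisional_flag_def n Let_def using X flat by auto
  then show ?thesis by blast
qed

theorem theorem4p27:
  fixes scale :: "'f::{field,finite} \<Rightarrow> 'v::ab_group_add \<Rightarrow> 'v"
    and Basis :: "'v set"
    and \<A> :: "'v set set"
  assumes "finite_dimensional_vector_space scale Basis"
    and "central_arrangement scale \<A>"
    and "pg_join_class TYPE('f) (dependence_matroid scale \<A>)"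
  shows "divisionally_free scale \<A>"
proof -
  let ?M = "dependence_matroid scale \<A>"
  have "simple_matroid ?M" using assms(3) by cases auto
  then interpret loopless_simple_matroid ?M by (simp add: loopless_simple_matroid_iff)
  show ?thesis
    using divisional_flag_exists[OF pg_join_class_avoids_thick[OF assms(3)]]
    by (simp add: divisionally_free_def)
qed

end
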